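(* For every $n>6$, the fourth largest (distinct) eigenvalue of the Transposition graph $T_n$ is $\frac{n(n-5)}{2}$, and its multiplicity is $\left(\frac{(n-1)(n-2)}{2}\right)^2$.
   Context: The Transposition graph $T_n$ is the Cayley graph $\mathrm{Cay}(\mathrm{Sym}_n,T)$ on the symmetric group $\mathrm{Sym}_n$, where $T$ is the set of all transpositions. Eigenvalues and multiplicities refer to its adjacency matrix. *)

theory Defs
  imports
    "HOL-Algebra.Sym_Groups"
    "Graph_Theory.Pair_Digraph"
    "Jordan_Normal_Form.Char_Poly"
begin

text \<open>An undirected simple graph is a symmetric irreflexive set of arcs. The Cayley graph is of
  this kind when \<open>S\<close> is closed under inverses and does not contain the identity.\<close>

definition cayley_graph :: "('a, 'b) monoid_scheme \<Rightarrow> 'a set \<Rightarrow> 'a pair_pre_digraph" where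
  "cayley_graph G S =
    \<lparr> pverts = carrier G, parcs = {(x, x \<otimes>\<^bsub>G\<^esub> s) | x s. x \<in> carrier G \<and> s \<in> S} \<rparr>"

definition transpositions :: "nat \<Rightarrow> (nat \<Rightarrow> nat) set" where
  "transpositions n =
    {Transposition.transpose i j | i j. i \<in> {1..n} \<and> j \<in> {1..n} \<and> i \<noteq> j}"

definition transposition_graph :: "nat \<Rightarrow> (nat \<Rightarrow> nat) pair_pre_digraph" where
  "transposition_graph n = cayley_graph (sym_group n) (transpositions n)"

definition vertex_enumeration :: "'a pair_pre_digraph \<Rightarrow> 'a list \<Rightarrow> bool" where
  "vertex_enumeration G vs \<longleftrightarrow> distinct vs \<and> set vs = pverts G"

definition adjacency_matrix :: "'a pair_pre_digraph \<Rightarrow> 'a list \<Rightarrow> real mat" where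
  "adjacency_matrix G vs =
    mat (length vs) (length vs) (\<lambda>(i, j). if (vs ! i, vs ! j) \<in> parcs G then 1 else 0)"

definition is_kth_largest :: "nat \<Rightarrow> 'a::linorder set \<Rightarrow> 'a \<Rightarrow> bool" where
  "is_kth_largest k S x \<longleftrightarrow>
    x \<in> S \<and> finite {y \<in> S. x < y} \<and> Suc (card {y \<in> S. x < y}) = k"

definition eigenvalue_multiplicity :: "real mat \<Rightarrow> real \<Rightarrow> nat" where
  "eigenvalue_multiplicity A a = Polynomial.order a (char_poly A)"

lemma cayley_transposition_graph_symmetric: "sym (parcs (transposition_graph n))"
proof (rule symI)
  fix x y assume "(x, y) \<in> parcs (transposition_graph n)"
  then obtain i j where ij: "x permutes {1..n}" "i \<in> {1..n}" "j \<in> {1..n}" "i \<noteq> j"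
    "y = x \<circ> Transposition.transpose i j"
    by (auto simp: transposition_graph_def cayley_graph_def transpositions_def sym_group_def)
  have "y permutes {1..n}"
    unfolding ij(5) by (intro permutes_compose permutes_swap_id ij)
  moreover have "x = y \<circ> Transposition.transpose i j"
    unfolding ij(5) by (simp add: comp_assoc)
  ultimately show "(y, x) \<in> parcs (transposition_graph n)"
    using ij(2-4)
    unfolding transposition_graph_def cayley_graph_def transpositions_def sym_group_def
    by simp blast
qed

lemma transposition_graph_irreflexive: "(x, x) \<notin> parcs (transposition_graph n)"
proof
  assume "(x, x) \<in> parcs (transposition_graph n)"
  then obtain i j where ij: "x permutes {1..n}" "i \<noteq> j" "x = x \<circ> Transposition.transpose i j"
    by (auto simp: transposition_graph_def cayley_graph_def transpositions_def sym_group_def)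
  have "x i = x j" using fun_cong[OF ij(3), of i] by simp
  with ij(1,2) show False by (auto dest: permutes_inj injD)
qed

end

theory Submission
  imports Defs "HOL-Library.Function_Algebras" "HOL-Computational_Algebra.Fundamental_Theorem_Algebra"
begin

text \<open>
  The adjacency operator is the sum of the Jucys--Murphy operators \<open>J\<^sub>k = \<Sum>\<^bsub>i<k\<^esub> (i k)\<close>, acting by right
  translation on functions on the symmetric group. These are commuting and symmetric, so there is a
  basis of joint eigenvectors. Following Okounkov and Vershik, the relation
  \<open>J\<^sub>i\<^sub>+\<^sub>1 s\<^sub>i = s\<^sub>i J\<^sub>i + 1\<close> forces every tuple of joint eigenvalues to be the content sequence of a standard
  tableau. An eigenvalue is therefore a sum of contents, and for \<open>n > 6\<close> the four largest sums belong to
  the shapes \<open>(n)\<close>, \<open>(n-1,1)\<close>, \<open>(n-2,2)\<close> and \<open>(n-2,1,1)\<close>. The last shape has \<open>(n-1 choose 2)\<close> tableaux, whose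
  joint eigenspaces all have the same dimension because of the intertwiners \<open>s\<^sub>i - 1/(a\<^sub>i\<^sub>+\<^sub>1 - a\<^sub>i)\<close>. For the
  tableau with \<open>1, \<dots>, n-2\<close> in the first row, the joint eigenspace consists of the functions
  \<open>g (x (n-1)) (x n)\<close> with \<open>g\<close> antisymmetric with vanishing row sums, so this dimension is again
  \<open>(n-1 choose 2)\<close>.
\<close>

section \<open>Content sequences\<close>

text \<open>Only one half of the correspondence between weights and tableaux is proved: the weight
  of a nonzero joint eigenvector is a content sequence. That a weight really occurs is needed for
  four shapes only, and there explicit functions of the last two values provide it, so no
  irreducible representation has to be constructed. Multiplicity means the order of a root of the
  characteristic polynomial; hence the need for a basis that is distributed over the weight spaces,
  so that basis vectors can be counted. That both factors of the multiplicity agree reflects the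
  regular representation, where an irreducible constituent occurs as often as its dimension. The
  bound on \<open>n\<close> is sharp: for \<open>n = 6\<close> the shapes (4,1,1) and (3,3) have the
  same content sum 3, and the eigenvalue would get a larger multiplicity.\<close>

text \<open>These are the conditions of Okounkov and Vershik. A new box is adjacent to an older one,
  hence the neighbouring content. Two successive boxes on one diagonal are opposite corners of a 2
  by 2 square, whose other two corners, of contents one more and one less, must be filled in
  between.\<close>

definition content_seq :: "nat \<Rightarrow> (nat \<Rightarrow> real) \<Rightarrow> bool" where
  "content_seq n a \<longleftrightarrow> a 1 = 0 \<and> (\<forall>q\<in>{2..n}. \<exists>r\<in>{1..<q}. \<bar>a r - a q\<bar> = 1) \<and>
    (\<forall>p q. 1 \<le> p \<longrightarrow> p < q \<longrightarrow> q \<le> n \<longrightarrow> a p = a q \<longrightarrow>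
       (\<exists>r\<in>{p<..<q}. a r = a p + 1) \<and> (\<exists>r\<in>{p<..<q}. a r = a p - 1))"

text \<open>All that the combinatorics needs to know about weights: closure under exchanging
  neighbours whose values do not differ by one, and two forbidden local patterns. The operators
  enter only when the assumptions are verified.\<close>

locale content_family =
  fixes n :: nat and C :: "(nat \<Rightarrow> real) set"
  assumes start: "a \<in> C \<Longrightarrow> a 1 = 0"
    and adjacent: "\<lbrakk>a \<in> C; 1 \<le> i; i < n\<rbrakk> \<Longrightarrow> a i \<noteq> a (Suc i)"
    and swap: "\<lbrakk>a \<in> C; 1 \<le> i; i < n; \<bar>a i - a (Suc i)\<bar> \<noteq> 1\<rbrakk> \<Longrightarrow> a \<circ> transpose i (Suc i) \<in> C"
    and braid: "\<lbrakk>a \<in> C; 1 \<le> i; Suc i < n; \<bar>a i - a (Suc i)\<bar> = 1\<rbrakk> \<Longrightarrow> a (Suc (Suc i)) \<noteq> a i"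
begin

text \<open>If the value just before position \<open>q\<close> does not differ by one, exchange the
  two and continue with the same value one place further left. The process cannot reach position 1:
  the value would then be 0 and \<open>a\<close> would start with two zeros.\<close>

lemma neighbour_before:
  assumes "a \<in> C" "2 \<le> q" "q \<le> n"
  shows "\<exists>r\<in>{1..<q}. \<bar>a r - a q\<bar> = 1"
  using assms
proof (induction q arbitrary: a rule: less_induct)
  case (less q)
  obtain q' where q': "q = Suc q'" using less.prems by (cases q) auto
  have q'n: "1 \<le> q'" "q' < n" using less.prems q' by auto
  show ?case
  proof (cases "\<bar>a q' - a q\<bar> = 1")
    case True
    then show ?thesis using q' q'n by (intro bexI[of _ q']) auto
  next
    case False
    let ?b = "a \<circ> transpose q' q"
    have b: "?b \<in> C" using swap[of a q'] less.prems False q' q'n by auto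
    show ?thesis
    proof (cases "q' = 1")
      case True
      then have "a 2 = 0" using start[OF b] q' by (simp add: numeral_2_eq_2)
      moreover have "a 1 = 0" using start less.prems by blast
      ultimately have False
        using adjacent[of a 1] less.prems by (simp add: numeral_2_eq_2)
      then show ?thesis ..
    next
      case False
      then obtain r where r: "r \<in> {1..<q'}" "\<bar>?b r - ?b q'\<bar> = 1"
        using less.IH[OF _ b, of q'] q' q'n by auto
      then have "?b r = a r" "?b q' = a q" using q' by (auto simp: transpose_def)
      then show ?thesis using r q' by (intro bexI[of _ r]) auto
    qed
  qed
qed

text \<open>Swapping an end of the interval with its inner neighbour shortens the interval, unless the
  neighbour's value differs by one.\<close>

lemma between_equal:
  assumes "a \<in> C" "1 \<le> p" "p < q" "q \<le> n" "a p = a q"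
  shows "(\<exists>r\<in>{p<..<q}. a r = a p + 1) \<and> (\<exists>r\<in>{p<..<q}. a r = a p - 1)"
  using assms
proof (induction "q - p" arbitrary: a p q rule: less_induct)
  case less
  obtain q' where q': "q = Suc q'" using less.prems by (cases q) auto
  have q'n: "1 \<le> q'" "q' < n" "p \<le> q'" using less.prems q' by auto
  have "p \<noteq> q'" using adjacent[of a p] less.prems q' by auto
  with q'n have pq': "p < q'" by auto
  show ?case
  proof (cases "\<bar>a q' - a q\<bar> = 1")
    case False
    let ?b = "a \<circ> transpose q' q"
    have b: "?b \<in> C" using swap[of a q'] less.prems False q' q'n by auto
    have eq: "?b r = a r" if "r < q'" for r using that q' by (auto simp: transpose_def)
    have "?b p = ?b q'" using eq[OF pq'] less.prems by simp
    from less.hyps[OF _ b _ pq' _ this] less.prems q' q'n pq'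
    have "(\<exists>r\<in>{p<..<q'}. ?b r = ?b p + 1) \<and> (\<exists>r\<in>{p<..<q'}. ?b r = ?b p - 1)" by simp
    then show ?thesis using eq pq' q' by fastforce
  next
    case T1: True
    show ?thesis
    proof (cases "\<bar>a p - a (Suc p)\<bar> = 1")
      case False
      let ?b = "a \<circ> transpose p (Suc p)"
      have b: "?b \<in> C" using swap[of a p] less.prems False by auto
      have eq: "?b r = a r" if "r > Suc p" for r using that by (auto simp: transpose_def)
      have bp: "?b (Suc p) = a p" by simp
      have "?b (Suc p) = ?b q" using eq[of q] less.prems pq' q' by simp
      from less.hyps[OF _ b _ _ _ this] less.prems q' pq'
      have "(\<exists>r\<in>{Suc p<..<q}. ?b r = ?b (Suc p) + 1) \<and> (\<exists>r\<in>{Suc p<..<q}. ?b r = ?b (Suc p) - 1)"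
        by simp
      then show ?thesis using eq bp by fastforce
    next
      case T2: True
      have "Suc p \<noteq> q'" using braid[of a p] less.prems q' T2 by auto
      with pq' have pq2: "Suc p < q'" by auto
      show ?thesis
      proof (cases "a (Suc p) = a q'")
        case True
        from less.hyps[OF _ less.prems(1) _ pq2 _ True] q' q'n
        have B: "(\<exists>r\<in>{Suc p<..<q'}. a r = a (Suc p) + 1) \<and> (\<exists>r\<in>{Suc p<..<q'}. a r = a (Suc p) - 1)"
          by simp
        \<comment> \<open>The inner interval has equal ends, so it contains both neighbours of
          \<open>a (Suc p)\<close>, one of which is \<open>a p\<close>. This gives a second
          occurrence \<open>r\<close> of \<open>a p\<close> before \<open>q\<close>, and the
          induction applies to the shorter interval from \<open>p\<close> to
          \<open>r\<close>.\<close>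
        have "a p = a (Suc p) + 1 \<or> a p = a (Suc p) - 1" using T2 by linarith
        then obtain r where r: "r \<in> {Suc p<..<q'}" "a r = a p"
          using B by auto
        have "(\<exists>s\<in>{p<..<r}. a s = a p + 1) \<and> (\<exists>s\<in>{p<..<r}. a s = a p - 1)"
          using less.hyps[OF _ less.prems(1,2), of r] r q' q'n by auto
        then show ?thesis using r q' by fastforce
      next
        case False
        have "(a (Suc p) = a p + 1 \<and> a q' = a p - 1) \<or> (a (Suc p) = a p - 1 \<and> a q' = a p + 1)"
          using T1 T2 False less.prems(5) by linarith
        then show ?thesis using pq2 q' by auto
      qed
    qed
  qed
qed

lemma content_seq: "a \<in> C \<Longrightarrow> content_seq n a"
  unfolding content_seq_def using start neighbour_before between_equal by simp

end

lemma content_seq_neighbour: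
  assumes "content_seq n a" "2 \<le> q" "q \<le> n"
  shows "\<exists>r\<in>{1..<q}. \<bar>a r - a q\<bar> = 1"
  using assms unfolding content_seq_def by simp

lemma content_seq_between:
  assumes "content_seq n a" "1 \<le> p" "p < q" "q \<le> n" "a p = a q"
  shows "\<exists>r\<in>{p<..<q}. a r = a p + 1" "\<exists>r\<in>{p<..<q}. a r = a p - 1"
  using assms unfolding content_seq_def by simp_all

text \<open>Negation is transposition of the tableau; it transfers statements about positive
  contents to negative ones.\<close>

lemma content_seq_uminus: "content_seq n a \<Longrightarrow> content_seq n (\<lambda>i. - a i)"
proof -
  assume a: "content_seq n a"
  have flip: "\<bar>- x - - y\<bar> = \<bar>x - y\<bar>" "(- x = - y + 1) = (x = y - 1)" "(- x = - y - 1) = (x = y + 1)"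
    for x y :: real by linarith+
  show ?thesis
    using a unfolding content_seq_def flip by simp
qed

text \<open>The earlier neighbour could be \<open>a q + 1\<close> instead. Going down twice by
  induction then reaches \<open>a q\<close> and afterwards \<open>a q - 1\<close>, at still earlier
  positions.\<close>

lemma content_seq_pred_before:
  assumes a: "content_seq n a" and "1 \<le> q" "q \<le> n" "a q > 0"
  shows "\<exists>r\<in>{1..<q}. a r = a q - 1"
  using assms(2-)
proof (induction q rule: less_induct)
  case (less q)
  have "q \<noteq> 1" using less.prems a by (auto simp: content_seq_def)
  then obtain r where r: "r \<in> {1..<q}" "\<bar>a r - a q\<bar> = 1"
    using content_seq_neighbour[OF a, of q] less.prems by auto
  show ?case
  proof (cases "a r = a q - 1")
    case False
    then have "a r = a q + 1" using r by linarith
    then obtain r' where r': "r' \<in> {1..<r}" "a r' = a q"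
      using less.IH[of r] r less.prems by auto
    then obtain r'' where "r'' \<in> {1..<r'}" "a r'' = a q - 1"
      using less.IH[of r'] r less.prems by auto
    then show ?thesis using r r' by auto
  qed (use r in blast)
qed

lemma content_seq_int:
  assumes a: "content_seq n a" and "q \<in> {1..n}"
  shows "a q \<in> \<int>"
  using assms(2)
proof (induction q rule: less_induct)
  case (less q)
  show ?case
  proof (cases "q = 1")
    case True
    then show ?thesis using a by (simp add: content_seq_def)
  next
    case False
    then obtain r where r: "r \<in> {1..<q}" "\<bar>a r - a q\<bar> = 1"
      using content_seq_neighbour[OF a, of q] less.prems by auto
    then have "a q = a r + 1 \<or> a q = a r - 1" by linarith
    moreover have "a r \<in> \<int>" using less r by auto
    ultimately show ?thesis by auto
  qed
qed

section \<open>Numbers of boxes on the diagonals\<close>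

definition content_mult :: "nat \<Rightarrow> (nat \<Rightarrow> real) \<Rightarrow> real \<Rightarrow> nat" where
  "content_mult n a c = card {i\<in>{1..n}. a i = c}"

text \<open>Map each position in \<open>S\<close> to the last earlier position of content
  \<open>c - 1\<close>. Since \<open>c - 1\<close> occurs between any two positions of content
  \<open>c\<close>, this map is strictly increasing. The set \<open>S\<close> is a parameter because
  it is the whole diagonal for positive \<open>c\<close>, but the diagonal without its first box in
  general.\<close>

lemma content_mult_pred:
  assumes a: "content_seq n a" and S: "S \<subseteq> {i\<in>{1..n}. a i = c}"
    and before: "\<And>q. q \<in> S \<Longrightarrow> \<exists>r\<in>{1..<q}. a r = c - 1"
  shows "card S \<le> content_mult n a (c - 1)"
proof -
  define g where "g q = Max {r\<in>{1..<q}. a r = c - 1}" for q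
  have g: "g q \<in> {r\<in>{1..<q}. a r = c - 1}" if "q \<in> S" for q
    unfolding g_def using before[OF that] by (intro Max_in) auto
  have less: "g p < g q" if pq: "p \<in> S" "q \<in> S" "p < q" for p q
  proof -
    have "1 \<le> p" "q \<le> n" "a p = a q" "a p = c" using pq S by auto
    then obtain r where r: "r \<in> {p<..<q}" "a r = c - 1"
      using content_seq_between(2)[OF a, of p q] pq by auto
    then have "r \<le> g q" unfolding g_def by (intro Max_ge) auto
    moreover have "g p < p" using g[OF pq(1)] by auto
    ultimately show ?thesis using r by auto
  qed
  have "inj_on g S"
    by (rule linorder_inj_onI') (use less in force)
  moreover have "g ` S \<subseteq> {i\<in>{1..n}. a i = c - 1}"
    using g S by fastforce
  ultimately show ?thesis unfolding content_mult_def
    by (intro card_inj_on_le) auto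
qed

lemma content_mult_decreasing:
  assumes "content_seq n a" "c > 0"
  shows "content_mult n a c \<le> content_mult n a (c - 1)"
  using content_mult_pred[OF assms(1) order.refl, of c] content_seq_pred_before[OF assms(1)] assms(2)
  unfolding content_mult_def by auto

text \<open>Only the first box of the diagonal may lack an earlier box of content
  \<open>c - 1\<close>, which accounts for the successor.\<close>

lemma content_mult_le_Suc:
  assumes a: "content_seq n a"
  shows "content_mult n a c \<le> Suc (content_mult n a (c - 1))"
proof (cases "{i\<in>{1..n}. a i = c} = {}")
  case False
  let ?S = "{i\<in>{1..n}. a i = c}"
  have fin: "finite ?S" by simp
  let ?m = "Min ?S"
  have m: "?m \<in> ?S" using Min_in[OF fin False] .
  have "card (?S - {?m}) \<le> content_mult n a (c - 1)"
  proof (rule content_mult_pred[OF a])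
    fix q assume q: "q \<in> ?S - {?m}"
    then have "?m \<le> q" "?m \<noteq> q" using Min_le[OF fin, of q] by blast+
    then have "?m < q" by simp
    moreover have "a ?m = a q" "1 \<le> ?m" "q \<le> n" "a ?m = c" using q m by auto
    ultimately obtain r where "r \<in> {?m<..<q}" "a r = c - 1"
      using content_seq_between(2)[OF a, of ?m q] by auto
    then show "\<exists>r\<in>{1..<q}. a r = c - 1" by (intro bexI[of _ r]) auto
  qed auto
  then show ?thesis using m fin unfolding content_mult_def by (simp add: card_Diff_singleton)
qed (unfold content_mult_def, metis card.empty le0)

lemma content_mult_uminus: "content_mult n (\<lambda>i. - a i) c = content_mult n a (- c)"
  unfolding content_mult_def by (rule arg_cong[where f = card]) auto

lemma antimono_support:
  fixes u :: "nat \<Rightarrow> nat"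
  assumes dec: "\<And>c. u (Suc c) \<le> u c" and zero: "u n = 0"
  obtains K where "K \<le> n" "\<And>c. 0 < u c \<longleftrightarrow> c < K"
proof
  let ?K = "LEAST c. u c = 0"
  have anti: "u d \<le> u c" if "c \<le> d" for c d
    using dec that by (rule lift_Suc_antimono_le)
  show "?K \<le> n" using zero by (rule Least_le)
  have "u ?K = 0" using zero by (rule LeastI)
  then show "0 < u c \<longleftrightarrow> c < ?K" for c
    using anti[of ?K c] not_less_Least[of c "\<lambda>c. u c = 0"] by (metis le_zero_eq neq0_conv not_less)
qed

text \<open>With decreasing weights on \<open>0, ..., K - 1\<close> the weighted mean of the index
  is at most the plain mean \<open>(K - 1) / 2\<close>; this is Chebyshev's inequality for
  oppositely ordered sequences, multiplied out to stay in the integers.\<close>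

lemma antimono_weighted_sum:
  fixes u :: "nat \<Rightarrow> nat"
  assumes dec: "\<And>c. u (Suc c) \<le> u c" and K: "\<And>c. 0 < u c \<longleftrightarrow> c < K" and "K \<le> n"
  shows "2 * (\<Sum>c<n. int c * int (u c)) \<le> (int K - 1) * (\<Sum>c<n. int (u c))"
    and "int K \<le> (\<Sum>c<n. int (u c))"
proof -
  have anti: "u d \<le> u c" if "c \<le> d" for c d
    using dec that by (rule lift_Suc_antimono_le)
  have cut: "(\<Sum>c<n. f c * int (u c)) = (\<Sum>c<K. f c * int (u c))" for f
  proof (rule sum.mono_neutral_right)
    show "\<forall>c\<in>{..<n} - {..<K}. f c * int (u c) = 0" using K by (metis DiffE lessThan_iff mult_zero_right neq0_conv of_nat_0)
  qed (use \<open>K \<le> n\<close> in auto)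
  have "of_nat K * (\<Sum>k=0..<K. int k * int (u k)) \<le> (\<Sum>k=0..<K. int k) * (\<Sum>k=0..<K. int (u k))"
    by (rule Chebyshev_sum_upper) (use anti in auto)
  then have "2 * (int K * (\<Sum>k<K. int k * int (u k))) \<le> (2 * (\<Sum>k<K. int k)) * (\<Sum>k<K. int (u k))"
    by (simp add: lessThan_atLeast0)
  moreover have "2 * (\<Sum>k<K. int k) = int K * (int K - 1)"
    for K by (induction K) (auto simp: algebra_simps)
  ultimately have "int K * (2 * (\<Sum>k<K. int k * int (u k))) \<le> int K * ((int K - 1) * (\<Sum>k<K. int (u k)))"
    by (simp add: algebra_simps)
  then have "2 * (\<Sum>k<K. int k * int (u k)) \<le> (int K - 1) * (\<Sum>k<K. int (u k))"
    by (cases "K = 0") auto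
  then show "2 * (\<Sum>c<n. int c * int (u c)) \<le> (int K - 1) * (\<Sum>c<n. int (u c))"
    using cut[of int] cut[of "\<lambda>_. 1"] by simp
  have "(\<Sum>c<K. 1::int) \<le> (\<Sum>c<K. int (u c))" using K by (intro sum_mono) (simp add: Suc_leI)
  then show "int K \<le> (\<Sum>c<n. int (u c))" using cut[of "\<lambda>_. 1"] by simp
qed

text \<open>Here \<open>u c\<close> and \<open>w c\<close> count the boxes of content \<open>c\<close> and \<open>-(c+1)\<close>, so \<open>K\<close> is the length of the first row
  and \<open>e = u - 1\<close> counts the boxes of content \<open>c\<close> outside of it. If \<open>K \<le> n - 4\<close>, Chebyshev's sum inequality gives the
  strict bound.\<close>

lemma content_sum_arith:
  fixes u w :: "nat \<Rightarrow> nat"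
  assumes n: "n > 6"
    and u_dec: "\<And>c. u (Suc c) \<le> u c" and w_dec: "\<And>c. w (Suc c) \<le> w c"
    and w0: "w 0 \<le> u 0" "u 0 \<le> Suc (w 0)" and u0: "0 < u 0"
    and un: "u n = 0"
    and total: "(\<Sum>c<n. int (u c)) + (\<Sum>c<n. int (w c)) = int n"
  defines "S \<equiv> (\<Sum>c<n. int c * int (u c)) - (\<Sum>c<n. (int c + 1) * int (w c))"
  shows "2 * S = int n * (int n - 1) \<or> 2 * S = int n * (int n - 3) \<or> 2 * S = (int n - 1) * (int n - 4)
     \<or> (2 * S = int n * (int n - 5) \<and> (\<forall>c. c + 3 \<le> n \<longrightarrow> u c = 1) \<and> w 0 = 1 \<and> w 1 = 1)
     \<or> 2 * S < int n * (int n - 5)"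
proof -
  have u_anti: "u d \<le> u c" if "c \<le> d" for c d using u_dec that by (rule lift_Suc_antimono_le)
  have w_anti: "w d \<le> w c" if "c \<le> d" for c d using w_dec that by (rule lift_Suc_antimono_le)
  obtain K where K: "K \<le> n" "\<And>c. 0 < u c \<longleftrightarrow> c < K" using antimono_support[of u, OF u_dec un] by blast
  have K0: "0 < K" using K(2)[of 0] u0 by simp
  define e where "e c = u c - 1" for c
  have e_dec: "e (Suc c) \<le> e c" for c using u_dec by (simp add: e_def diff_le_mono)
  have "e n = 0" using un by (simp add: e_def)
  then obtain L where L: "L \<le> n" "\<And>c. 0 < e c \<longleftrightarrow> c < L" using antimono_support[of e, OF e_dec] by blast
  define U W E Q R where "U = (\<Sum>c<n. int (u c))" and "W = (\<Sum>c<n. int (w c))" and "E = (\<Sum>c<n. int (e c))"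
    and "Q = (\<Sum>c<n. int c * int (e c))" and "R = (\<Sum>c<n. (int c + 1) * int (w c))"
  have ue: "int (u c) = int (e c) + (if c < K then 1 else 0)" for c using K(2)[of c] by (auto simp: e_def)
  have iv: "(\<Sum>c<n. if c < K then f c else 0) = (\<Sum>c<K. f c)" for f :: "nat \<Rightarrow> int"
    using K(1) by (intro sum.mono_neutral_cong_right) auto
  have U: "U = E + int K" unfolding U_def E_def ue sum.distrib iv by simp
  have "(\<Sum>c<n. int c * int (u c)) = Q + (\<Sum>c<n. if c < K then int c else 0)"
    unfolding Q_def ue distrib_left sum.distrib by (simp add: if_distrib cong: if_cong)
  also have "\<dots> = Q + (\<Sum>c<K. int c)" unfolding iv ..
  finally have P': "(\<Sum>c<n. int c * int (u c)) = Q + (\<Sum>c<K. int c)" .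
  have "2 * (\<Sum>c<k. int c) = int k * (int k - 1)" for k by (induction k) (auto simp: algebra_simps)
  with P' have P: "2 * (\<Sum>c<n. int c * int (u c)) = 2 * Q + int K * (int K - 1)" by simp
  have S: "2 * S = 2 * Q + int K * (int K - 1) - 2 * R" using P unfolding S_def R_def by simp
  have Q1: "2 * Q \<le> (int L - 1) * E" and LE: "int L \<le> E"
    using antimono_weighted_sum[of e, OF e_dec L(2) L(1)] unfolding Q_def E_def by blast+
  have E0: "0 \<le> E" unfolding E_def by (simp add: sum_nonneg)
  have Q0: "0 \<le> Q" unfolding Q_def by (simp add: sum_nonneg)
  have Q2: "2 * Q \<le> (E - 1) * E" using Q1 LE E0 by (smt (verit) mult_right_mono)
  have RW: "W \<le> R" unfolding R_def W_def by (intro sum_mono) (simp add: algebra_simps)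
  have EW: "E + W = int n - int K" using total U unfolding U_def W_def by simp
  have W0: "int (w 0) \<le> W" unfolding W_def using n by (intro member_le_sum) auto
  \<comment> \<open>Unless everything lies in the first row, some content is negative:
    \<open>w 0 = 0\<close> would give \<open>u 0 \<le> 1\<close>, so no box of nonnegative content
    is left outside the first row either.\<close>
  have W1: "W \<ge> 1" if "K < n"
  proof (rule ccontr)
    assume "\<not> W \<ge> 1"
    then have "w 0 = 0" using W0 by simp
    then have "e c = 0" for c using w0(2) u_anti[of 0 c] by (simp add: e_def)
    then have "E = 0" unfolding E_def by simp
    then show False using EW that \<open>\<not> W \<ge> 1\<close> by simp
  qed
  have split2: "(\<Sum>c<n. f c) = f 0 + f 1 + (\<Sum>c=2..<n. f c)" for f :: "nat \<Rightarrow> int"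
    using n by (simp add: lessThan_atLeast0 sum.atLeast_Suc_lessThan numeral_2_eq_2)
  have w1: "w 0 \<ge> 1" if "W \<ge> 1"
  proof (rule ccontr)
    assume "\<not> w 0 \<ge> 1"
    then have "w c = 0" for c using w_anti[of 0 c] by simp
    then have "W = 0" unfolding W_def by simp
    then show False using that by simp
  qed
  consider "K = n" | "K = n - 1" | "K = n - 2" | "K = n - 3" | "int K \<le> int n - 4" using K(1) by linarith
  then show ?thesis
  proof cases
    case 1
    then have "W = 0" "E = 0" using EW E0 W0 by linarith+
    moreover from this have "R = 0"
      unfolding W_def R_def by (simp add: sum_nonneg_eq_0_iff)
    ultimately have "Q = 0" "R = 0" using Q0 Q2 by auto
    then show ?thesis using S 1 by simp
  next
    case 2
    then have "W = 1" "E = 0" using EW E0 W1 n by linarith+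
    moreover have "w 0 = 1" using w1 W0 \<open>W = 1\<close> by simp
    moreover have R: "R = 1" 
    proof -
      have "W = int (w 0) + int (w 1) + (\<Sum>c=2..<n. int (w c))" unfolding W_def by (rule split2)
      moreover have "0 \<le> (\<Sum>c=2..<n. int (w c))" by (simp add: sum_nonneg)
      ultimately have z: "w 1 = 0" using \<open>W = 1\<close> \<open>w 0 = 1\<close> by linarith
      then have "w c = 0" if "c \<ge> 1" for c using w_anti[OF that] by simp
      then show ?thesis unfolding R_def split2 using \<open>w 0 = 1\<close> by simp
    qed
    ultimately have "Q = 0" using Q0 Q2 by auto
    have K': "int K = int n - 1" using 2 n by simp
    have "2 * S = int n * (int n - 3)" using S \<open>Q = 0\<close> R unfolding K' by (simp add: algebra_simps)
    then show ?thesis by simp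
  next
    case 3
    have K': "int K = int n - 2" using 3 n by simp
    have Wge: "W \<ge> 1" using W1 3 n by simp
    have w0': "w 0 \<ge> 1" using w1[OF Wge] .
    have Wsplit: "W = int (w 0) + int (w 1) + (\<Sum>c=2..<n. int (w c))" unfolding W_def by (rule split2)
    have pos: "0 \<le> (\<Sum>c=2..<n. int (w c))" by (simp add: sum_nonneg)
    have "E \<le> 1" using EW K' Wge by linarith
    then have "E = 0 \<or> E = 1" using E0 by linarith
    then have Q: "Q = 0" using Q0 Q2 by auto
    \<comment> \<open>The two remaining boxes are either one of content 0 and one of content -1, as
      in the shape (n-2,2), or of contents -1 and -2, as in the hook (n-2,1,1).\<close>
    show ?thesis
    proof (cases "E = 1")
      case True
      then have "W = 1" using EW K' by simp
      then have z: "w 1 = 0" "w 0 = 1" using Wsplit pos w0' by linarith+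
      then have "w c = 0" if "c \<ge> 1" for c using w_anti[OF that] by simp
      then have "R = 1" unfolding R_def split2 using \<open>w 0 = 1\<close> by simp
      then have "2 * S = (int n - 1) * (int n - 4)" using S Q unfolding K' by (simp add: algebra_simps)
      then show ?thesis by simp
    next
      case False
      then have E: "E = 0" using \<open>E \<le> 1\<close> E0 by simp
      then have W: "W = 2" using EW K' by simp
      from E have "e c = 0" if "c < n" for c using that unfolding E_def by (simp add: sum_nonneg_eq_0_iff)
      then have uc: "u c = 1" if "c < K" for c using ue[of c] that K(1) by simp
      then have "u 0 = 1" using K0 by simp
      then have z0: "w 0 = 1" using w0' w0 by simp
      have z1: "w 1 = 1"
      proof (rule ccontr)
        assume "w 1 \<noteq> 1"
        then have "w 1 = 0" using w_anti[of 0 1] z0 by simp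
        then have "w c = 0" if "c \<ge> 1" for c using w_anti[OF that] by simp
        then show False using Wsplit W z0 by simp
      qed
      then have "w 2 = 0" using Wsplit W z0 n
        by (simp add: sum_nonneg_eq_0_iff)
      then have "w c = 0" if "c \<ge> 2" for c using w_anti[OF that] by simp
      then have "R = 3" unfolding R_def split2 using z0 z1 by simp
      then have "2 * S = int n * (int n - 5)" using S Q unfolding K' by (simp add: algebra_simps)
      moreover have "u c = 1" if "c + 3 \<le> n" for c using uc[of c] that 3 by simp
      ultimately show ?thesis using z0 z1 by simp
    qed
  next
    case 4
    have K': "int K = int n - 3" using 4 n by simp
    have Wge: "W \<ge> 1" using W1 4 n by simp
    then have "E \<le> 2" using EW K' by linarith
    then have "E = 0 \<or> E = 1 \<or> E = 2" using E0 by linarith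
    then have "2 * Q \<le> 2" using Q2 by auto
    then have "2 * S \<le> int K * (int K - 1)" using S RW Wge by linarith
    \<comment> \<open>Here \<open>(n - 3) * (n - 4) < n * (n - 5)\<close> is equivalent to
      \<open>n > 6\<close>. This is where the hypothesis is sharp: for \<open>n = 6\<close> the
      shape (3,3) gives equality.\<close>
    also have "\<dots> < int n * (int n - 5)" unfolding K' using n by (simp add: algebra_simps)
    finally show ?thesis by simp
  next
    case 5
    have Wge: "W \<ge> 1" using W1 5 by simp
    have "2 * (\<Sum>c<n. int c * int (u c)) \<le> (int K - 1) * U"
      using antimono_weighted_sum(1)[of u, OF u_dec K(2) K(1)] unfolding U_def .
    also have "\<dots> \<le> (int n - 5) * U" using 5 U E0 by (intro mult_right_mono) auto
    also have "\<dots> \<le> (int n - 5) * int n" using n Wge EW U by (intro mult_left_mono) auto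
    \<comment> \<open>The nonnegative contents alone give only a weak inequality; the term
      \<open>R\<close>, at least 1, makes it strict.\<close>
    finally have "2 * S \<le> (int n - 5) * int n - 2 * R" unfolding S_def R_def by simp
    then show ?thesis using RW Wge by (simp add: mult.commute)
  qed
qed


lemma content_seq_le:
  assumes a: "content_seq n a" and "1 \<le> q" "q \<le> n"
  shows "a q \<le> real q - 1"
  using assms(2-)
proof (induction q rule: less_induct)
  case (less q)
  show ?case
  proof (cases "a q > 0")
    case True
    then obtain r where "r \<in> {1..<q}" "a r = a q - 1"
      using content_seq_pred_before[OF a] less.prems by blast
    with less.IH[of r] less.prems show ?thesis by auto
  qed (use less.prems in auto)
qed

text \<open>Contents of the tableau of shape \<open>(n-2,1,1)\<close> with first column \<open>1, p, q\<close>.\<close>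

definition hook_content :: "nat \<Rightarrow> nat \<Rightarrow> nat \<Rightarrow> real" where
  "hook_content p q i = (if i = p then -1 else if i = q then -2
     else real i - 1 - of_bool (p < i) - of_bool (q < i))"

text \<open>Regrouping by diagonals works because contents are integers strictly between
  \<open>-n\<close> and \<open>n\<close>. The lemma serves twice, with the floor for the content sum
  and with the constant 1 for the number of boxes; \<open>h\<close> is integer valued so that the
  result feeds the integer arithmetic above.\<close>

lemma content_seq_value_sum:
  fixes h :: "real \<Rightarrow> int"
  assumes a: "content_seq n a"
  shows "(\<Sum>i=1..n. h (a i)) = (\<Sum>c<n. h (real c) * int (content_mult n a (real c)))
    + (\<Sum>c<n. h (- real (Suc c)) * int (content_mult n a (- real (Suc c))))"
proof -
  let ?P = "real ` {..<n}" and ?N = "(\<lambda>c. - real (Suc c)) ` {..<n}"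
  have sub: "a ` {1..n} \<subseteq> ?P \<union> ?N"
  proof (clarify)
    fix i assume i: "i \<in> {1..n}" "a i \<notin> ?N"
    obtain z where z: "a i = of_int z" using content_seq_int[OF a i(1)] by (auto elim: Ints_cases)
    have "a i \<le> real i - 1" "- a i \<le> real i - 1"
      using content_seq_le[OF a, of i] content_seq_le[OF content_seq_uminus[OF a], of i] i by auto
    then have zn: "z < int n" "- z < int n" using z i by auto
    show "a i \<in> ?P"
    proof (cases "z \<ge> 0")
      case True
      then show ?thesis using z zn by (intro image_eqI[of _ _ "nat z"]) auto
    next
      case False
      then have "a i = - real (Suc (nat (- z - 1)))" "nat (- z - 1) < n" using z zn by auto
      then have "a i \<in> ?N" by blast
      then show ?thesis using i by blast
    qed
  qed
  have "(\<Sum>i=1..n. h (a i)) = (\<Sum>c\<in>?P \<union> ?N. \<Sum>i\<in>{i\<in>{1..n}. a i = c}. h (a i))"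
    using sub by (intro sum.group[symmetric]) auto
  also have "\<dots> = (\<Sum>c\<in>?P \<union> ?N. h c * int (content_mult n a c))"
    unfolding content_mult_def by (intro sum.cong) (auto simp: mult.commute)
  also have "\<dots> = (\<Sum>c\<in>?P. h c * int (content_mult n a c)) + (\<Sum>c\<in>?N. h c * int (content_mult n a c))"
  proof (rule sum.union_disjoint)
    have "real c \<noteq> - real (Suc d)" for c d by (simp add: add_eq_0_iff2)
    then show "?P \<inter> ?N = {}" by auto
  qed auto
  also have "(\<Sum>c\<in>?P. h c * int (content_mult n a c)) = (\<Sum>c<n. h (real c) * int (content_mult n a (real c)))"
    by (subst sum.reindex) auto
  also have "(\<Sum>c\<in>?N. h c * int (content_mult n a c)) =
      (\<Sum>c<n. h (- real (Suc c)) * int (content_mult n a (- real (Suc c))))"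
    by (subst sum.reindex) (auto simp: inj_on_def)
  finally show ?thesis .
qed

text \<open>The arithmetic is applied to the diagonals \<open>c\<close> and \<open>-(c+1)\<close>.
  The inequalities linking \<open>w 0\<close> and \<open>u 0\<close> compare the diagonals -1 and 0,
  once from each side. Only the fourth alternative records multiplicities, since only there the
  sequence must be recovered for counting.\<close>

lemma content_sum_classification:
  assumes a: "content_seq n a" and n: "n > 6"
  defines "S \<equiv> \<Sum>i=1..n. a i"
  shows "S = real n * (real n - 1) / 2 \<or> S = real n * (real n - 3) / 2 \<or> S = (real n - 1) * (real n - 4) / 2
     \<or> (S = real n * (real n - 5) / 2 \<and> (\<forall>c. c + 3 \<le> n \<longrightarrow> content_mult n a (real c) = 1)
         \<and> content_mult n a (-1) = 1 \<and> content_mult n a (-2) = 1)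
     \<or> S < real n * (real n - 5) / 2"
proof -
  define u where "u c = content_mult n a (real c)" for c
  define w where "w c = content_mult n a (- real (Suc c))" for c
  note a' = content_seq_uminus[OF a]
  define T where "T = (\<Sum>c<n. int c * int (u c)) - (\<Sum>c<n. (int c + 1) * int (w c))"
  have fl: "real_of_int \<lfloor>a i\<rfloor> = a i" if "i \<in> {1..n}" for i using content_seq_int[OF a that] by simp
  have neg: "\<lfloor>- real (Suc c)\<rfloor> * int (w c) = - ((int c + 1) * int (w c))" for c
  proof -
    have "- real (Suc c) = of_int (- (int c + 1))" by simp
    then have "\<lfloor>- real (Suc c)\<rfloor> = - (int c + 1)" by (metis floor_of_int)
    then show ?thesis by (simp only: mult_minus_left)
  qed
  have "(\<Sum>i=1..n. \<lfloor>a i\<rfloor>) = T"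
    using content_seq_value_sum[OF a, of floor]
    unfolding T_def u_def[symmetric] w_def[symmetric] neg sum_negf by simp
  then have S: "S = of_int T" unfolding S_def using fl by (metis (mono_tags, lifting) of_int_sum sum.cong)
  have bound: "a i < real n" "- a i < real n" if "i \<in> {1..n}" for i
    using content_seq_le[OF a, of i] content_seq_le[OF a', of i] that by auto
  have "2 * T = int n * (int n - 1) \<or> 2 * T = int n * (int n - 3) \<or> 2 * T = (int n - 1) * (int n - 4)
     \<or> (2 * T = int n * (int n - 5) \<and> (\<forall>c. c + 3 \<le> n \<longrightarrow> u c = 1) \<and> w 0 = 1 \<and> w 1 = 1)
     \<or> 2 * T < int n * (int n - 5)"
    unfolding T_def
  proof (rule content_sum_arith[OF n])
    show "u (Suc c) \<le> u c" for c
      using content_mult_decreasing[OF a, of "real (Suc c)"] by (simp add: u_def)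
    show "w (Suc c) \<le> w c" for c
      using content_mult_decreasing[OF a', of "real (Suc (Suc c))"] by (simp add: w_def content_mult_uminus)
    show "w 0 \<le> u 0"
      using content_mult_decreasing[OF a', of 1] by (simp add: w_def u_def content_mult_uminus)
    show "u 0 \<le> Suc (w 0)"
      using content_mult_le_Suc[OF a, of 0] by (simp add: w_def u_def)
    have "1 \<in> {i\<in>{1..n}. a i = 0}" using a n by (auto simp: content_seq_def)
    then show "0 < u 0" unfolding u_def content_mult_def by (auto simp: card_gt_0_iff)
    show "u n = 0" using bound unfolding u_def content_mult_def by force
    show "(\<Sum>c<n. int (u c)) + (\<Sum>c<n. int (w c)) = int n"
      using content_seq_value_sum[OF a, of "\<lambda>_. 1"] by (simp add: u_def w_def)
  qed
  moreover have "2 * T = x \<longleftrightarrow> S = real_of_int x / 2" "2 * T < x \<longleftrightarrow> S < real_of_int x / 2" for x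
    unfolding S by linarith+
  ultimately show ?thesis by (simp add: u_def w_def)
qed

text \<open>Each content \<open>c > 0\<close> needs an earlier \<open>c - 1\<close>. As all contents
  occur once, the nonnegative ones appear in increasing order, and -1 precedes -2. The positions
  \<open>p\<close> and \<open>q\<close> of these two therefore determine the sequence;
  \<open>2 \<le> p\<close> because the first content is 0.\<close>

lemma hook_content_of_mult:
  assumes a: "content_seq n a" and n: "n > 6"
    and m: "\<And>c. c + 3 \<le> n \<Longrightarrow> content_mult n a (real c) = 1" "content_mult n a (-1) = 1" "content_mult n a (-2) = 1"
  obtains p q where "2 \<le> p" "p < q" "q \<le> n" "\<And>i. i \<in> {1..n} \<Longrightarrow> a i = hook_content p q i"
proof -
  note a' = content_seq_uminus[OF a]
  obtain p where p: "{i\<in>{1..n}. a i = -1} = {p}" using m(2) unfolding content_mult_def by (rule card_1_singletonE)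
  obtain q where q: "{i\<in>{1..n}. a i = -2} = {q}" using m(3) unfolding content_mult_def by (rule card_1_singletonE)
  have p': "p \<in> {1..n}" "a p = -1" and q': "q \<in> {1..n}" "a q = -2" using p q by blast+
  have a1: "a 1 = 0" using a by (simp add: content_seq_def)
  have "p \<noteq> 1" using a1 p' by auto
  then have p2: "2 \<le> p" using p' by auto
  obtain r where r: "r \<in> {1..<q}" "- a r = - a q - 1"
    using content_seq_pred_before[OF a', of q] q' by auto
  then have "r \<in> {i\<in>{1..n}. a i = -1}" using q' by auto
  then have "r = p" using p by blast
  then have pq: "p < q" using r by auto
  define X where "X = {1..n} - {p, q}"
  define pos where "pos c = (THE i. i \<in> {1..n} \<and> a i = real c)" for c :: nat
  have pos: "pos c \<in> {1..n}" "a (pos c) = real c" and pos_unique: "\<And>i. i \<in> {1..n} \<Longrightarrow> a i = real c \<Longrightarrow> i = pos c"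
    if c: "c + 3 \<le> n" for c
  proof -
    obtain i where i: "{i\<in>{1..n}. a i = real c} = {i}"
      using m(1)[OF c] unfolding content_mult_def by (rule card_1_singletonE)
    then have ex: "\<exists>!i. i \<in> {1..n} \<and> a i = real c" by (metis (mono_tags, lifting) mem_Collect_eq singleton_iff)
    from theI'[OF ex] show "pos c \<in> {1..n}" "a (pos c) = real c" unfolding pos_def by auto
    with ex show "\<And>i. i \<in> {1..n} \<Longrightarrow> a i = real c \<Longrightarrow> i = pos c" by blast
  qed
  have pos_mono: "pos c < pos d" if "c < d" "d + 3 \<le> n" for c d
    using that
  proof (induction d)
    case (Suc d)
    obtain r where r: "r \<in> {1..<pos (Suc d)}" "a r = a (pos (Suc d)) - 1"
      using content_seq_pred_before[OF a, of "pos (Suc d)"] pos[OF Suc.prems(2)] by auto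
    have "r = pos d" using r pos[OF Suc.prems(2)] Suc.prems(2) by (intro pos_unique) auto
    then show ?case using Suc r by (cases "c = d") auto
  qed simp
  have lessThan_n: "c < n - 2 \<longleftrightarrow> c + 3 \<le> n" for c using n by auto
  have inj: "inj_on pos {..<n-2}"
    by (rule linorder_inj_onI') (use pos_mono in force)
  have "pos ` {..<n-2} \<subseteq> X"
  proof
    fix i assume "i \<in> pos ` {..<n-2}"
    then obtain c where "c + 3 \<le> n" "i = pos c" using lessThan_n by auto
    with pos[of c] p' q' show "i \<in> X" unfolding X_def by auto
  qed
  moreover have "card X = n - 2"
    unfolding X_def using p' q' pq by (subst card_Diff_subset) auto
  ultimately have X: "pos ` {..<n-2} = X"
    by (intro card_subset_eq) (auto simp: card_image[OF inj] X_def)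
  have "a i = hook_content p q i" if i: "i \<in> {1..n}" for i
  proof (cases "i = p \<or> i = q")
    case True
    then show ?thesis using p' q' pq by (auto simp: hook_content_def)
  next
    case False
    then have "i \<in> pos ` {..<n-2}" using i X by (auto simp: X_def)
    then obtain c where c: "c + 3 \<le> n" "i = pos c" using lessThan_n by auto
    \<comment> \<open>The content at \<open>i\<close> is found by counting: the earlier positions
      other than \<open>p\<close> and \<open>q\<close> are exactly those of the \<open>c\<close>
      smaller nonnegative contents.\<close>
    have "{1..<i} - {p, q} = pos ` {..<c}"
    proof (intro equalityI subsetI)
      fix j assume j: "j \<in> {1..<i} - {p, q}"
      then have "j \<in> pos ` {..<n-2}" using i X by (auto simp: X_def)
      then obtain d where d: "d + 3 \<le> n" "j = pos d" using lessThan_n by auto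
      then have "d < c" using pos_mono[of c d] j c by (cases d c rule: linorder_cases) auto
      then show "j \<in> pos ` {..<c}" using d by auto
    next
      fix j assume "j \<in> pos ` {..<c}"
      then obtain d where d: "d < c" "j = pos d" by auto
      then have "j < i" using pos_mono[of d c] c by auto
      moreover have "j \<in> X" using d c X by auto
      ultimately show "j \<in> {1..<i} - {p, q}" by (auto simp: X_def)
    qed
    moreover have "card (pos ` {..<c}) = c"
      using card_image[OF inj_on_subset[OF inj, of "{..<c}"]] c by auto
    ultimately have "card ({1..<i} - {p, q}) = c" by simp
    moreover have "{1..<i} - {p, q} = {1..<i} - ({p, q} \<inter> {1..<i})" by auto
    ultimately have card: "card {1..<i} - card ({p, q} \<inter> {1..<i}) = c"
      by (simp add: card_Diff_subset)
    have "{p, q} \<inter> {1..<i} = (if p < i then {p} else {}) \<union> (if q < i then {q} else {})"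
      using p' q' by auto
    then have "card ({p, q} \<inter> {1..<i}) = of_bool (p < i) + of_bool (q < i)" using pq by auto
    with card have "i - 1 - (of_bool (p < i) + of_bool (q < i)) = c" by simp
    \<comment> \<open>Guards the truncated subtraction on \<open>nat\<close> before passing to the
      reals.\<close>
    moreover have "of_bool (p < i) + of_bool (q < i) \<le> i - 1" using p2 pq i by auto
    ultimately have "real c = real i - 1 - of_bool (p < i) - of_bool (q < i)"
      using i by (auto simp: of_bool_def split: if_splits)
    then show ?thesis using pos[OF c(1)] c(2) False by (simp add: hook_content_def)
  qed
  then show ?thesis using that[OF p2 pq] q' by auto
qed

section \<open>Symmetric operators on function spaces\<close>

definition fscale :: "real \<Rightarrow> ('a \<Rightarrow> real) \<Rightarrow> 'a \<Rightarrow> real" where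
  "fscale c f = (\<lambda>x. c * f x)"

lemma fscale_apply: "fscale c f x = c * f x"
  by (simp add: fscale_def)

text \<open>As simplification rules, the pointwise equations would also expand unapplied functions.\<close>

declare plus_fun_apply [simp del] zero_fun_apply [simp del] minus_apply [simp del] uminus_apply [simp del]
  times_fun_apply [simp del] one_fun_apply [simp del]

lemmas pointwise = fun_eq_iff fscale_apply plus_fun_apply zero_fun_apply minus_apply uminus_apply

global_interpretation fs: vector_space fscale
  by unfold_locales (auto simp: pointwise algebra_simps)

lemma sum_fun_apply: "(\<Sum>i\<in>A. f i) x = (\<Sum>i\<in>A. f i x :: real)"
  by (induction A rule: infinite_finite_induct) (auto simp: pointwise)

text \<open>Functions on \<open>G\<close> are represented by total functions that vanish elsewhere.
  This makes \<open>inprod G\<close> positive definite and equality of functions on \<open>G\<close>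
  plain equality.\<close>

definition fspace :: "'a set \<Rightarrow> ('a \<Rightarrow> real) set" where
  "fspace G = {f. \<forall>x. x \<notin> G \<longrightarrow> f x = 0}"

lemma subspace_fspace: "fs.subspace (fspace G)"
  by (auto simp: fs.subspace_def fspace_def pointwise)

definition inprod :: "'a set \<Rightarrow> ('a \<Rightarrow> real) \<Rightarrow> ('a \<Rightarrow> real) \<Rightarrow> real" where
  "inprod G f g = (\<Sum>x\<in>G. f x * g x)"

lemma inprod_simps:
  "inprod G (f + g) h = inprod G f h + inprod G g h"
  "inprod G f (g + h) = inprod G f g + inprod G f h"
  "inprod G (f - g) h = inprod G f h - inprod G g h"
  "inprod G f (g - h) = inprod G f g - inprod G f h"
  "inprod G (fscale c f) g = c * inprod G f g"
  "inprod G f (fscale c g) = c * inprod G f g"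
  "inprod G 0 f = 0" "inprod G f 0 = 0"
  by (simp_all add: inprod_def pointwise algebra_simps sum.distrib sum_subtractf sum_distrib_left)

lemma inprod_commute: "inprod G f g = inprod G g f"
  by (simp add: inprod_def mult.commute)

lemma inprod_self_nonneg: "inprod G f f \<ge> 0"
  by (simp add: inprod_def sum_nonneg)

lemma inprod_self_eq_0:
  assumes "finite G" "f \<in> fspace G" "inprod G f f = 0"
  shows "f = 0"
proof
  fix x
  have "\<forall>x\<in>G. f x * f x = 0"
    using assms(1,3) unfolding inprod_def by (subst (asm) sum_nonneg_eq_0_iff) auto
  then show "f x = 0 x" using assms(2) by (cases "x \<in> G") (auto simp: fspace_def pointwise)
qed

definition unit_fun :: "'a \<Rightarrow> 'a \<Rightarrow> real" where
  "unit_fun x = (\<lambda>y. of_bool (y = x))"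

lemma fspace_span_unit:
  assumes "finite G" "f \<in> fspace G"
  shows "f \<in> fs.span (unit_fun ` G)"
proof -
  have "f = (\<Sum>x\<in>G. fscale (f x) (unit_fun x))"
    using assms by (auto simp: pointwise sum_fun_apply unit_fun_def fspace_def of_bool_def if_distrib cong: if_cong)
  also have "\<dots> \<in> fs.span (unit_fun ` G)"
    by (intro fs.span_sum fs.span_scale fs.span_base) auto
  finally show ?thesis .
qed

section \<open>Polynomials in a symmetric operator\<close>

text \<open>This is \<open>p(J) f\<close>, evaluated by Horner's scheme.\<close>

definition poly_act :: "(('a \<Rightarrow> real) \<Rightarrow> 'a \<Rightarrow> real) \<Rightarrow> real poly \<Rightarrow> ('a \<Rightarrow> real) \<Rightarrow> 'a \<Rightarrow> real" where
  "poly_act J p f = fold_coeffs (\<lambda>a g. fscale a f + J g) p 0"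

text \<open>Take a complex root \<open>z\<close>. If \<open>z\<close> is not real, divide by the
  real quadratic with roots \<open>z\<close> and its conjugate; the remainder has degree at most
  one, real coefficients and the nonreal root \<open>z\<close>, so it is zero. The quadratic is kept
  with parameters \<open>u\<close> and \<open>v\<close> to display it as a sum of squares.\<close>

lemma real_poly_factor:
  fixes p :: "real poly"
  assumes deg: "degree p > 0"
  shows "(\<exists>a q. p = [:-a, 1:] * q) \<or> (\<exists>u v q. v \<noteq> 0 \<and> p = [:u\<^sup>2 + v\<^sup>2, -2 * u, 1:] * q)"
proof -
  define ev where "ev r z = poly (map_poly complex_of_real r) z" for r z
  have ev_pCons: "ev (pCons a r) z = of_real a + z * ev r z" for a r z
    by (simp add: ev_def Polynomial.map_poly_pCons)
  have ev_0: "ev 0 z = 0" for z by (simp add: ev_def)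
  have ev_add: "ev (r + s) z = ev r z + ev s z" for r s z
    by (induction r s rule: poly_induct2) (auto simp: ev_pCons ev_0 algebra_simps)
  have ev_smult: "ev (Polynomial.smult a r) z = of_real a * ev r z" for a r z
    by (induction r) (auto simp: ev_pCons ev_0 algebra_simps)
  have ev_mult: "ev (r * s) z = ev r z * ev s z" for r s z
    by (induction r) (auto simp: ev_pCons ev_0 ev_add ev_smult algebra_simps)
  have "degree (map_poly complex_of_real p) = degree p" by (simp add: degree_map_poly)
  then have "\<not> constant (poly (map_poly complex_of_real p))" using deg by (simp add: constant_degree)
  then obtain z where z: "ev p z = 0" using fundamental_theorem_of_algebra unfolding ev_def by blast
  show ?thesis
  proof (cases "Im z = 0")
    case True
    then have "z = of_real (Re z)" by (simp add: complex_eq_iff)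
    moreover have "ev r (of_real x) = of_real (poly r x)" for r x
      by (induction r) (auto simp: ev_pCons ev_0)
    ultimately have "poly p (Re z) = 0" using z by (metis of_real_eq_0_iff)
    then show ?thesis by (metis dvdE poly_eq_0_iff_dvd)
  next
    case False
    let ?m = "[:(Re z)\<^sup>2 + (Im z)\<^sup>2, -2 * Re z, 1:]"
    define r where "r = p mod ?m"
    have p: "p = ?m * (p div ?m) + r" unfolding r_def by (rule mult_div_mod_eq[symmetric])
    have "ev ?m z = 0"
      by (simp add: ev_pCons ev_0 complex_eq_iff power2_eq_square algebra_simps)
    moreover have "ev p z = ev ?m z * ev (p div ?m) z + ev r z"
      by (subst p) (simp only: ev_add ev_mult)
    ultimately have rz: "ev r z = 0" using z by simp
    have "r = 0 \<or> degree r < 2" using degree_mod_less[of ?m p] by (auto simp: r_def)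
    then obtain b c where r: "r = [:b, c:]"
    proof -
      assume "r = 0 \<or> degree r < 2" and *: "\<And>b c. r = [:b, c:] \<Longrightarrow> thesis"
      then consider "degree r = 0" | "degree r = 1" by fastforce
      then show thesis
      proof cases
        case 1
        then obtain b where "r = [:b:]" by (elim degree_eq_zeroE)
        then show ?thesis using *[of b 0] by simp
      next
        case 2
        then show ?thesis using * by (elim degree1_coeffs) blast
      qed
    qed
    have "complex_of_real b + z * complex_of_real c = 0" using rz unfolding r by (simp add: ev_pCons ev_0)
    then have "c = 0" "b = 0" using False by (auto simp: complex_eq_iff)
    then have "p = ?m * (p div ?m)" using p r by simp
    then show ?thesis using False by blast
  qed
qed

context
  fixes J :: "('a \<Rightarrow> real) \<Rightarrow> 'a \<Rightarrow> real"
  assumes lin: "Vector_Spaces.linear fscale fscale J"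
begin

interpretation J: Vector_Spaces.linear fscale fscale J by (fact lin)

lemma poly_act_0 [simp]: "poly_act J 0 f = 0"
  by (simp add: poly_act_def)

lemma poly_act_pCons [simp]: "poly_act J (pCons a p) f = fscale a f + J (poly_act J p f)"
  by (cases "a = 0 \<and> p = 0") (auto simp: poly_act_def J.zero)

lemma poly_act_add: "poly_act J (p + q) f = poly_act J p f + poly_act J q f"
  by (induction p q rule: poly_induct2) (auto simp: J.add fs.scale_left_distrib)

lemma poly_act_smult: "poly_act J (Polynomial.smult c p) f = fscale c (poly_act J p f)"
  by (induction p) (auto simp: J.scale fs.scale_right_distrib)

lemma poly_act_mult: "poly_act J (p * q) f = poly_act J p (poly_act J q f)"
  by (induction p) (auto simp: poly_act_add poly_act_smult)

lemma poly_act_sum: "poly_act J (\<Sum>i\<in>A. p i) f = (\<Sum>i\<in>A. poly_act J (p i) f)"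
  by (induction A rule: infinite_finite_induct) (auto simp: poly_act_add)

lemma poly_act_monom: "poly_act J (Polynomial.monom c i) f = fscale c ((J ^^ i) f)"
  by (induction i) (auto simp: monom_0 monom_Suc J.scale J.zero)

lemma poly_act_diff_scale: "poly_act J p (f - fscale c g) = poly_act J p f - fscale c (poly_act J p g)"
  by (induction p) (auto simp: J.diff J.scale J.add fs.scale_right_diff_distrib fs.scale_right_distrib mult.commute)

lemma poly_act_eigen: "J g = fscale a g \<Longrightarrow> poly_act J p g = fscale (poly p a) g"
  by (induction p) (auto simp: J.scale fs.scale_left_distrib mult.commute)

lemma poly_act_mem:
  assumes "fs.subspace W" "\<And>f. f \<in> W \<Longrightarrow> J f \<in> W" "f \<in> W"
  shows "poly_act J p f \<in> W"
  by (induction p) (auto simp: assms fs.subspace_0 fs.subspace_add fs.subspace_scale)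

text \<open>The \<open>card G + 1\<close> vectors \<open>f, J f, J (J f), ...\<close> lie in a space
  spanned by \<open>card G\<close> vectors, and a relation among them is a polynomial.\<close>

lemma annihilating_poly_exists:
  assumes G: "finite G" and inv: "\<And>f. f \<in> fspace G \<Longrightarrow> J f \<in> fspace G" and f: "f \<in> fspace G"
  obtains p where "p \<noteq> 0" "poly_act J p f = 0"
proof -
  let ?v = "\<lambda>i. (J ^^ i) f"
  have v: "?v i \<in> fspace G" for i by (induction i) (auto simp: f inv)
  show ?thesis
  proof (cases "inj_on ?v {..card G}")
    \<comment> \<open>Linear dependence is stated for sets, which do not see a repeated vector; a
      repetition yields its own polynomial, a difference of two monomials.\<close>
    case False
    then obtain i j where ij: "i \<noteq> j" "?v i = ?v j" by (auto simp: inj_on_def)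
    show ?thesis
    proof
      have "coeff (Polynomial.monom 1 i + Polynomial.monom (-1) j) i = (1::real)" using ij by simp
      then show "Polynomial.monom 1 i + Polynomial.monom (-1) j \<noteq> (0 :: real poly)" by force
      show "poly_act J (Polynomial.monom 1 i + Polynomial.monom (-1) j) f = 0"
        using ij by (simp add: poly_act_add poly_act_monom)
    qed
  next
    case True
    let ?S = "?v ` {..card G}"
    have "\<not> fs.independent ?S"
    proof
      assume "fs.independent ?S"
      moreover have "?S \<subseteq> fs.span (unit_fun ` G)" using fspace_span_unit[OF G] v by blast
      ultimately have "card ?S \<le> card (unit_fun ` G)"
        using fs.independent_span_bound[of "unit_fun ` G" ?S] G by blast
      also have "\<dots> \<le> card G" using G by (rule card_image_le)
      finally show False using card_image[OF True] by simp
    qed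
    then obtain u where u: "\<exists>x\<in>?S. u x \<noteq> 0" "(\<Sum>x\<in>?S. fscale (u x) x) = 0"
      using fs.dependent_finite[of ?S] by auto
    let ?p = "\<Sum>i\<le>card G. Polynomial.monom (u (?v i)) i"
    show ?thesis
    proof
      obtain i where i: "i \<le> card G" "u (?v i) \<noteq> 0" using u(1) by auto
      have "coeff ?p i = u (?v i)" using i by (simp add: coeff_sum)
      then show "?p \<noteq> 0" using i by force
      have "poly_act J ?p f = (\<Sum>i\<le>card G. fscale (u (?v i)) (?v i))"
        by (simp add: poly_act_sum poly_act_monom)
      also have "\<dots> = (\<Sum>x\<in>?S. fscale (u x) x)" using True by (subst sum.reindex) (auto simp: o_def)
      finally show "poly_act J ?p f = 0" using u(2) by simp
    qed
  qed
qed

lemma annihilated_in_span_eigenvectors: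
  assumes G: "finite G" and W: "fs.subspace W" "W \<subseteq> fspace G"
    and inv: "\<And>f. f \<in> W \<Longrightarrow> J f \<in> W"
    and sym: "\<And>f g. f \<in> W \<Longrightarrow> g \<in> W \<Longrightarrow> inprod G (J f) g = inprod G f (J g)"
    and "p \<noteq> 0" "f \<in> W" "poly_act J p f = 0"
  shows "f \<in> fs.span {g\<in>W. \<exists>c. J g = fscale c g}" (is "_ \<in> fs.span ?E")
  using \<open>p \<noteq> 0\<close> \<open>f \<in> W\<close> \<open>poly_act J p f = 0\<close>
proof (induction "degree p" arbitrary: p f rule: less_induct)
  case less
  have mem: "poly_act J q f \<in> W" for q using poly_act_mem[OF W(1) inv] less.prems by blast
  show ?case
  proof (cases "degree p = 0")
    case True
    then obtain c where "p = [:c:]" by (elim degree_eq_zeroE)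
    then have "c \<noteq> 0" "fscale c f = 0" using less.prems by (auto simp: J.zero)
    then have "f = 0" by simp
    then show ?thesis using fs.span_zero by simp
  next
    case False
    have step: "f \<in> fs.span ?E" if "p = m * q" "degree m > 0" "poly_act J q f = 0" for m q
    proof (rule less.hyps)
      have "m \<noteq> 0" "q \<noteq> 0" using that less.prems by auto
      then show "degree q < degree p" using that by (simp add: degree_mult_eq)
    qed (use that less.prems in auto)
    have "degree p > 0" using False by simp
    from real_poly_factor[OF this] show ?thesis
    proof (elim disjE exE conjE)
      fix a q assume p: "p = [:-a, 1:] * q"
      define h where "h = poly_act J q f"
      have hW: "h \<in> W" unfolding h_def by (rule mem)
      have "poly_act J [:-a, 1:] h = 0" using less.prems p poly_act_mult h_def by metis
      then have Jh: "J h = fscale a h" by (simp add: J.zero)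
      show ?thesis
      proof (cases "poly q a = 0")
        case True
        then obtain r where r: "q = [:-a, 1:] * r" by (metis dvdE poly_eq_0_iff_dvd)
        define g where "g = poly_act J r f"
        have gW: "g \<in> W" unfolding g_def by (rule mem)
        have "h = poly_act J [:-a, 1:] g" unfolding h_def r poly_act_mult g_def ..
        then have h: "h = J g - fscale a g" by (simp add: J.zero)
        have "inprod G h h = inprod G h (J g) - a * inprod G h g"
          by (subst (2) h) (simp add: inprod_simps)
        also have "inprod G h (J g) = inprod G (J h) g" using sym hW gW by simp
        finally have "inprod G h h = 0" by (simp add: Jh inprod_simps)
        then have "h = 0" using inprod_self_eq_0[OF G] hW W(2) by blast
        then show ?thesis using step[OF p] h_def by simp
      next
        case qa: False
        let ?f = "f - fscale (1 / poly q a) h"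
        have q0: "q \<noteq> 0" using less.prems p by auto
        \<comment> \<open>\<open>q(J)\<close> maps \<open>f\<close> to \<open>h\<close> and
          multiplies the eigenvector \<open>h\<close> by \<open>q(a)\<close>, so this multiple of
          \<open>h\<close> is the right correction.\<close>
        have "poly_act J q ?f = 0"
          unfolding poly_act_diff_scale poly_act_eigen[OF Jh] h_def[symmetric] using qa by simp
        moreover have "?f \<in> W" using less.prems hW W(1) by (simp add: fs.subspace_diff fs.subspace_scale)
        moreover have "degree q < degree p" unfolding p using q0 by (subst degree_mult_eq) auto
        ultimately have "?f \<in> fs.span ?E" using less.hyps q0 by blast
        moreover have "fscale (1 / poly q a) h \<in> fs.span ?E" using hW Jh by (intro fs.span_scale fs.span_base) auto
        ultimately have "?f + fscale (1 / poly q a) h \<in> fs.span ?E" by (rule fs.span_add)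
        then show ?thesis by simp
      qed
    next
      fix u v q assume v: "v \<noteq> 0" and p: "p = [:u\<^sup>2 + v\<^sup>2, -2 * u, 1:] * q"
      define h where "h = poly_act J q f"
      have hW: "h \<in> W" unfolding h_def by (rule mem)
      have "poly_act J [:u\<^sup>2 + v\<^sup>2, -2 * u, 1:] h = 0" using less.prems p poly_act_mult h_def by metis
      then have Jh: "fscale (u\<^sup>2 + v\<^sup>2) h + fscale (-2 * u) (J h) + J (J h) = 0"
        by (simp only: poly_act_pCons poly_act_0 J.zero J.add J.scale fs.scale_one add_0_right add.assoc)
      let ?g = "J h - fscale u h"
      \<comment> \<open>The quadratic factor is \<open>(J - u)\<^sup>2 + v\<^sup>2\<close>, and by
        symmetry its quadratic form at \<open>h\<close> is a sum of two squared norms.\<close>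
      have "inprod G ?g ?g + v\<^sup>2 * inprod G h h
          = inprod G (fscale (u\<^sup>2 + v\<^sup>2) h + fscale (-2 * u) (J h) + J (J h)) h"
        using sym[OF inv[OF hW] hW]
        by (simp add: inprod_simps inprod_commute[of G h "J h"] algebra_simps power2_eq_square)
      then have "inprod G ?g ?g + v\<^sup>2 * inprod G h h = 0" unfolding Jh by (simp add: inprod_simps)
      then have "v\<^sup>2 * inprod G h h = 0"
        using inprod_self_nonneg[of G ?g] inprod_self_nonneg[of G h] by (smt (verit) mult_nonneg_nonneg zero_le_power2)
      then have "inprod G h h = 0" using v by simp
      then have "h = 0" using inprod_self_eq_0[OF G] hW W(2) by blast
      then show ?thesis using step[OF p] h_def by simp
    qed
  qed
qed

end

text \<open>Operators are added one at a time. A joint eigenvector of the first \<open>m\<close>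
  operators lies in a common eigenspace \<open>W\<close>, which the next operator preserves because
  it commutes with the others; inside \<open>W\<close> it decomposes into eigenvectors of that
  operator.\<close>

lemma joint_eigenvectors_span:
  fixes J :: "nat \<Rightarrow> ('a \<Rightarrow> real) \<Rightarrow> 'a \<Rightarrow> real"
  assumes G: "finite G"
    and lin: "\<And>k. k \<in> {1..n} \<Longrightarrow> Vector_Spaces.linear fscale fscale (J k)"
    and inv: "\<And>k f. k \<in> {1..n} \<Longrightarrow> f \<in> fspace G \<Longrightarrow> J k f \<in> fspace G"
    and sym: "\<And>k f g. k \<in> {1..n} \<Longrightarrow> f \<in> fspace G \<Longrightarrow> g \<in> fspace G \<Longrightarrow> inprod G (J k f) g = inprod G f (J k g)"
    and comm: "\<And>k l f. k \<in> {1..n} \<Longrightarrow> l \<in> {1..n} \<Longrightarrow> J k (J l f) = J l (J k f)"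
    and f: "f \<in> fspace G"
  shows "f \<in> fs.span {g\<in>fspace G. \<forall>k\<in>{1..n}. \<exists>c. J k g = fscale c g}"
proof -
  define E where "E m = {g\<in>fspace G. \<forall>k\<in>{1..m}. \<exists>c. J k g = fscale c g}" for m
  have "fspace G \<subseteq> fs.span (E m)" if "m \<le> n" for m
    using that
  proof (induction m)
    case 0
    have "E 0 = fspace G" by (simp add: E_def)
    then show ?case by (simp add: fs.span_superset)
  next
    case (Suc m)
    have k: "Suc m \<in> {1..n}" using Suc.prems by simp
    interpret Jm: Vector_Spaces.linear fscale fscale "J (Suc m)" by (rule lin[OF k])
    have "E m \<subseteq> fs.span (E (Suc m))"
    proof
      fix g assume g: "g \<in> E m"
      then have "\<forall>k\<in>{1..m}. \<exists>c. J k g = fscale c g" by (simp add: E_def)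
      then obtain c where c: "\<And>k. k \<in> {1..m} \<Longrightarrow> J k g = fscale (c k) g" by metis
      define W where "W = {h\<in>fspace G. \<forall>k\<in>{1..m}. J k h = fscale (c k) h}"
      have gW: "g \<in> W" using g c by (simp add: W_def E_def)
      have WG: "W \<subseteq> fspace G" by (auto simp: W_def)
      have sub: "fs.subspace W"
      proof (rule fs.subspaceI)
        have "J k 0 = 0" if "k \<in> {1..m}" for k
          using Vector_Spaces.linear.axioms lin[of k] that Suc.prems
          by (intro module_hom.zero[of fscale fscale]) (auto simp: Vector_Spaces.linear_def)
        then show "0 \<in> W" using fs.subspace_0[OF subspace_fspace] by (auto simp: W_def)
      next
        fix x y assume xy: "x \<in> W" "y \<in> W"
        have "J k (x + y) = J k x + J k y" if "k \<in> {1..m}" for k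
          using lin[of k] that Suc.prems
          by (intro module_hom.add[of fscale fscale]) (auto simp: Vector_Spaces.linear_def)
        then show "x + y \<in> W"
          using xy fs.subspace_add[OF subspace_fspace] by (auto simp: W_def fs.scale_right_distrib)
      next
        fix b x assume x: "x \<in> W"
        have "J k (fscale b x) = fscale b (J k x)" if "k \<in> {1..m}" for k
          using lin[of k] that Suc.prems
          by (intro module_hom.scale[of fscale fscale]) (auto simp: Vector_Spaces.linear_def)
        then show "fscale b x \<in> W"
          using x fs.subspace_scale[OF subspace_fspace] by (auto simp: W_def mult.commute)
      qed
      have inv': "J (Suc m) h \<in> W" if h: "h \<in> W" for h
      proof -
        have "J l (J (Suc m) h) = fscale (c l) (J (Suc m) h)" if l: "l \<in> {1..m}" for l
        proof -
          have "J l (J (Suc m) h) = J (Suc m) (J l h)" using comm[of l "Suc m" h] l Suc.prems by auto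
          also have "J l h = fscale (c l) h" using h l by (simp add: W_def)
          finally show ?thesis by (simp add: Jm.scale)
        qed
        then show ?thesis using h inv[OF k, of h] by (simp add: W_def)
      qed
      obtain p where p: "p \<noteq> 0" "poly_act (J (Suc m)) p g = 0"
        using annihilating_poly_exists[OF lin[OF k] G inv[OF k]] gW WG by blast
      have "g \<in> fs.span {h\<in>W. \<exists>c. J (Suc m) h = fscale c h}"
        using annihilated_in_span_eigenvectors[OF lin[OF k] G sub WG inv' _ p(1) gW p(2)] sym[OF k] WG by blast
      moreover have "{h\<in>W. \<exists>c. J (Suc m) h = fscale c h} \<subseteq> E (Suc m)"
        by (auto simp: E_def W_def le_Suc_eq)
      ultimately show "g \<in> fs.span (E (Suc m))" using fs.span_mono by blast
    qed
    then have "fs.span (E m) \<subseteq> fs.span (E (Suc m))" by (rule fs.span_minimal) simp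
    then show ?case using Suc by auto
  qed
  then show ?thesis using f unfolding E_def by blast
qed

section \<open>Jucys--Murphy operators\<close>

definition perms :: "nat \<Rightarrow> (nat \<Rightarrow> nat) set" where
  "perms n = {x. x permutes {1..n}}"

lemma finite_perms [simp]: "finite (perms n)"
  by (simp add: perms_def finite_permutations)

definition rtrans :: "('a \<Rightarrow> 'a) \<Rightarrow> (('a \<Rightarrow> 'a) \<Rightarrow> real) \<Rightarrow> ('a \<Rightarrow> 'a) \<Rightarrow> real" where
  "rtrans g f = (\<lambda>x. f (x \<circ> g))"

definition JM :: "nat \<Rightarrow> ((nat \<Rightarrow> nat) \<Rightarrow> real) \<Rightarrow> (nat \<Rightarrow> nat) \<Rightarrow> real" where
  "JM k f = (\<Sum>i=1..<k. rtrans (transpose i k) f)"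

lemma JM_apply: "JM k f x = (\<Sum>i=1..<k. f (x \<circ> transpose i k))"
  by (simp add: JM_def sum_fun_apply rtrans_def)

lemma fs_linearI:
  assumes "\<And>f g. J (f + g) = J f + J g" "\<And>c f. J (fscale c f) = fscale c (J f)"
  shows "Vector_Spaces.linear fscale fscale J"
  using assms by unfold_locales

lemma linear_rtrans: "Vector_Spaces.linear fscale fscale (rtrans g)"
  by (rule fs_linearI) (auto simp: rtrans_def pointwise)

lemma linear_JM: "Vector_Spaces.linear fscale fscale (JM k)"
  by (rule fs_linearI) (auto simp: JM_apply pointwise sum.distrib sum_distrib_left)

interpretation rtrans: Vector_Spaces.linear fscale fscale "rtrans g"
  by (rule linear_rtrans)

interpretation JM: Vector_Spaces.linear fscale fscale "JM k"
  by (rule linear_JM)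

lemma rtrans_rtrans: "rtrans g (rtrans h f) = rtrans (g \<circ> h) f"
  by (simp add: rtrans_def comp_assoc)

lemma comp_permutes_iff:
  assumes "g permutes S"
  shows "x \<circ> g permutes S \<longleftrightarrow> x permutes S"
proof
  assume "x \<circ> g permutes S"
  then have "(x \<circ> g) \<circ> Hilbert_Choice.inv g permutes S"
    by (rule permutes_compose[OF permutes_inv[OF assms]])
  then show "x permutes S" by (simp only: comp_assoc permutes_inv_o(1)[OF assms] comp_id)
qed (use assms in \<open>auto intro: permutes_compose\<close>)

lemma rtrans_fspace:
  "g permutes {1..n} \<Longrightarrow> f \<in> fspace (perms n) \<Longrightarrow> rtrans g f \<in> fspace (perms n)"
  by (auto simp: fspace_def rtrans_def perms_def comp_permutes_iff)

lemma JM_fspace: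
  assumes "k \<in> {1..n}" "f \<in> fspace (perms n)"
  shows "JM k f \<in> fspace (perms n)"
  unfolding JM_def
  by (intro fs.subspace_sum subspace_fspace rtrans_fspace permutes_swap_id) (use assms in auto)

lemma inprod_rtrans:
  assumes "g permutes {1..n}" "g \<circ> g = id"
  shows "inprod (perms n) (rtrans g f) h = inprod (perms n) f (rtrans g h)"
  unfolding inprod_def rtrans_def
  by (rule sum.reindex_bij_witness[where i = "\<lambda>x. x \<circ> g" and j = "\<lambda>x. x \<circ> g"])
    (use assms in \<open>auto simp: perms_def comp_permutes_iff comp_assoc\<close>)

lemma inprod_sum:
  "inprod G (\<Sum>i\<in>A. f i) g = (\<Sum>i\<in>A. inprod G (f i) g)"
  "inprod G g (\<Sum>i\<in>A. f i) = (\<Sum>i\<in>A. inprod G g (f i))"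
  by (induction A rule: infinite_finite_induct) (auto simp: inprod_simps)

lemma inprod_JM:
  assumes "k \<in> {1..n}"
  shows "inprod (perms n) (JM k f) g = inprod (perms n) f (JM k g)"
  unfolding JM_def inprod_sum
  by (intro sum.cong refl inprod_rtrans permutes_swap_id) (use assms in auto)

lemma transpose_conj:
  assumes "inj g"
  shows "g \<circ> transpose i j = transpose (g i) (g j) \<circ> g"
  using injD[OF assms] by (auto simp: fun_eq_iff transpose_def)

text \<open>Conjugation by a permutation of the numbers below \<open>k\<close> merely permutes the
  transpositions \<open>(i k)\<close> with \<open>i < k\<close>. All commutation of the operators
  \<open>JM\<close> follows, since the smaller one is built from such permutations.\<close>

lemma JM_rtrans_commute:
  assumes g: "g permutes {1..<k}"
  shows "JM k (rtrans g f) = rtrans g (JM k f)"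
proof
  fix x
  have gk: "g k = k" using permutes_not_in[OF g] by simp
  have conj: "g \<circ> transpose i k = transpose (g i) k \<circ> g" for i
    using transpose_conj[OF permutes_inj[OF g], of i k] gk by simp
  have "rtrans g (JM k f) x = (\<Sum>i=1..<k. f (x \<circ> (transpose (g i) k \<circ> g)))"
    unfolding rtrans_def JM_apply comp_assoc conj ..
  also have "\<dots> = (\<Sum>i=1..<k. f (x \<circ> (transpose i k \<circ> g)))"
    using sum.permute[OF g, of "\<lambda>i. f (x \<circ> (transpose i k \<circ> g))"] by (simp add: o_def)
  finally show "JM k (rtrans g f) x = rtrans g (JM k f) x"
    by (simp add: rtrans_def JM_apply comp_assoc)
qed

lemma JM_JM_commute_less:
  assumes "k < l"
  shows "JM k (JM l f) = JM l (JM k f)"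
proof -
  have "JM l (JM k f) = (\<Sum>i=1..<k. JM l (rtrans (transpose i k) f))"
    unfolding JM_def[of k] JM.sum ..
  also have "\<dots> = (\<Sum>i=1..<k. rtrans (transpose i k) (JM l f))"
    by (intro sum.cong refl JM_rtrans_commute permutes_swap_id) (use assms in auto)
  finally show ?thesis unfolding JM_def[of k] ..
qed

lemma JM_JM_commute: "JM k (JM l f) = JM l (JM k f)"
  using JM_JM_commute_less by (cases k l rule: linorder_cases) metis+

definition adj_swap :: "nat \<Rightarrow> ((nat \<Rightarrow> nat) \<Rightarrow> real) \<Rightarrow> (nat \<Rightarrow> nat) \<Rightarrow> real" where
  "adj_swap i = rtrans (transpose i (Suc i))"

interpretation adj_swap: Vector_Spaces.linear fscale fscale "adj_swap i"
  unfolding adj_swap_def by (rule linear_rtrans)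

lemma adj_swap_involutory [simp]: "adj_swap i (adj_swap i f) = f"
  by (simp add: adj_swap_def rtrans_rtrans) (simp add: rtrans_def)

lemma adj_swap_braid:
  "adj_swap i (adj_swap (Suc i) (adj_swap i f)) = adj_swap (Suc i) (adj_swap i (adj_swap (Suc i) f))"
proof -
  have "transpose i (Suc i) \<circ> (transpose (Suc i) (Suc (Suc i)) \<circ> transpose i (Suc i)) =
    transpose (Suc i) (Suc (Suc i)) \<circ> (transpose i (Suc i) \<circ> transpose (Suc i) (Suc (Suc i)))"
    by (auto simp: fun_eq_iff transpose_def)
  then show ?thesis by (simp add: adj_swap_def rtrans_rtrans comp_assoc)
qed

lemma adj_swap_fspace:
  "1 \<le> i \<Longrightarrow> i < n \<Longrightarrow> f \<in> fspace (perms n) \<Longrightarrow> adj_swap i f \<in> fspace (perms n)"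
  unfolding adj_swap_def by (intro rtrans_fspace permutes_swap_id) auto

lemma inprod_adj_swap:
  "1 \<le> i \<Longrightarrow> i < n \<Longrightarrow> inprod (perms n) (adj_swap i f) g = inprod (perms n) f (adj_swap i g)"
  unfolding adj_swap_def by (intro inprod_rtrans permutes_swap_id) auto

lemma JM_adj_swap_commute:
  assumes "1 \<le> i" "k \<noteq> i" "k \<noteq> Suc i"
  shows "JM k (adj_swap i f) = adj_swap i (JM k f)"
proof (cases "k < i")
  case True
  have "transpose j k \<circ> transpose i (Suc i) = transpose i (Suc i) \<circ> transpose j k" if "j < k" for j
    using that True by (auto simp: fun_eq_iff transpose_def)
  then show ?thesis
    unfolding adj_swap_def JM_def rtrans.sum rtrans_rtrans by (intro sum.cong) auto
next
  case False
  then show ?thesis unfolding adj_swap_def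
    by (intro JM_rtrans_commute permutes_swap_id) (use assms in auto)
qed

text \<open>Conjugation by \<open>(i i+1)\<close> turns \<open>(j i)\<close> into
  \<open>(j i+1)\<close>. The one summand of \<open>JM (Suc i)\<close> not obtained this way is
  \<open>(i i+1)\<close> itself, and it leaves the extra \<open>f\<close>.\<close>

lemma JM_Suc_adj_swap:
  assumes "1 \<le> i"
  shows "JM (Suc i) (adj_swap i f) = adj_swap i (JM i f) + f"
proof -
  have "transpose j (Suc i) \<circ> transpose i (Suc i) = transpose i (Suc i) \<circ> transpose j i" if "j < i" for j
    using that by (auto simp: fun_eq_iff transpose_def)
  then have "(\<Sum>j=1..<i. rtrans (transpose j (Suc i)) (adj_swap i f)) = adj_swap i (JM i f)"
    unfolding adj_swap_def JM_def rtrans.sum rtrans_rtrans by (intro sum.cong) auto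
  moreover have "rtrans (transpose i (Suc i)) (adj_swap i f) = f"
    unfolding adj_swap_def[symmetric] by simp
  ultimately show ?thesis using assms by (simp add: JM_def[of "Suc i"])
qed

lemma JM_adj_swap:
  assumes "1 \<le> i"
  shows "JM i (adj_swap i f) = adj_swap i (JM (Suc i) f) - f"
  using JM_Suc_adj_swap[OF assms, of "adj_swap i f"] by (simp add: adj_swap.add)

section \<open>Weight spaces and intertwiners\<close>

definition weight_space :: "nat \<Rightarrow> (nat \<Rightarrow> real) \<Rightarrow> ((nat \<Rightarrow> nat) \<Rightarrow> real) set" where
  "weight_space n a = {f \<in> fspace (perms n). \<forall>k\<in>{1..n}. JM k f = fscale (a k) f}"

lemma subspace_weight_space: "fs.subspace (weight_space n a)"
  using subspace_fspace[of "perms n"]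
  by (auto simp: fs.subspace_def weight_space_def JM.add JM.scale JM.zero fs.scale_right_distrib mult.commute)

lemma weight_space_cong:
  "(\<And>k. k \<in> {1..n} \<Longrightarrow> a k = b k) \<Longrightarrow> weight_space n a = weight_space n b"
  by (auto simp: weight_space_def)

lemma weight_space_orthogonal:
  assumes "f \<in> weight_space n a" "g \<in> weight_space n b" "k \<in> {1..n}" "a k \<noteq> b k"
  shows "inprod (perms n) f g = 0"
proof -
  have "a k * inprod (perms n) f g = b k * inprod (perms n) f g"
    using inprod_JM[OF assms(3), of f g] assms by (simp add: weight_space_def inprod_simps)
  then show ?thesis using assms(4) by simp
qed

definition intertwiner :: "nat \<Rightarrow> (nat \<Rightarrow> real) \<Rightarrow> ((nat \<Rightarrow> nat) \<Rightarrow> real) \<Rightarrow> (nat \<Rightarrow> nat) \<Rightarrow> real" where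
  "intertwiner i a f = adj_swap i f - fscale (1 / (a (Suc i) - a i)) f"

lemma linear_intertwiner: "Vector_Spaces.linear fscale fscale (intertwiner i a)"
  by (rule fs_linearI)
    (auto simp: intertwiner_def adj_swap.add adj_swap.scale fs.scale_right_distrib
      fs.scale_right_diff_distrib mult.commute)

lemma intertwiner_weight_space:
  assumes i: "1 \<le> i" "i < n" and f: "f \<in> weight_space n a" and neq: "a i \<noteq> a (Suc i)"
  shows "intertwiner i a f \<in> weight_space n (a \<circ> transpose i (Suc i))"
proof -
  define d where "d = 1 / (a (Suc i) - a i)"
  \<comment> \<open>The defining property of the coefficient: it absorbs the inhomogeneous term
    \<open>f\<close> of the commutation relation into an exchange of \<open>a i\<close> and
    \<open>a (Suc i)\<close>.\<close>
  have d: "d * a (Suc i) = 1 + d * a i" using neq by (simp add: d_def field_simps)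
  have fG: "f \<in> fspace (perms n)" and fk: "\<And>k. k \<in> {1..n} \<Longrightarrow> JM k f = fscale (a k) f"
    using f by (auto simp: weight_space_def)
  have phi: "intertwiner i a f = adj_swap i f - fscale d f" by (simp add: intertwiner_def d_def)
  have "intertwiner i a f \<in> fspace (perms n)"
    unfolding phi using i fG by (intro fs.subspace_diff subspace_fspace adj_swap_fspace fs.subspace_scale)
  moreover have "JM k (intertwiner i a f) = fscale ((a \<circ> transpose i (Suc i)) k) (intertwiner i a f)"
    if k: "k \<in> {1..n}" for k
  proof -
    consider "k = i" | "k = Suc i" | "k \<noteq> i" "k \<noteq> Suc i" by blast
    then show ?thesis
    proof cases
      case 1
      have "JM k (intertwiner i a f) = fscale (a (Suc i)) (adj_swap i f) - f - fscale (d * a i) f"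
        using i fk[of i] fk[of "Suc i"] unfolding phi 1
        by (simp add: JM.diff JM.scale JM_adj_swap adj_swap.scale)
      also have "\<dots> = fscale (a (Suc i)) (adj_swap i f) - fscale (d * a (Suc i)) f"
        unfolding d by (simp add: pointwise algebra_simps)
      finally show ?thesis unfolding phi 1 by (simp add: pointwise algebra_simps)
    next
      case 2
      have "JM k (intertwiner i a f) = fscale (a i) (adj_swap i f) + f - fscale (d * a (Suc i)) f"
        using i fk[of i] fk[of "Suc i"] unfolding phi 2
        by (simp add: JM.diff JM.scale JM_Suc_adj_swap adj_swap.scale)
      also have "\<dots> = fscale (a i) (adj_swap i f) - fscale (d * a i) f"
        unfolding d by (simp add: pointwise algebra_simps)
      finally show ?thesis unfolding phi 2 by (simp add: pointwise algebra_simps)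
    next
      case 3
      then have "(a \<circ> transpose i (Suc i)) k = a k" by (simp add: transpose_def)
      then show ?thesis using i 3 fk[OF k] unfolding phi
        by (simp add: JM.diff JM.scale JM_adj_swap_commute adj_swap.scale fs.scale_right_diff_distrib mult.commute)
    qed
  qed
  ultimately show ?thesis by (simp add: weight_space_def)
qed

text \<open>With \<open>s\<close> the adjacent swap and \<open>d\<close> the coefficient, this is
  \<open>(s + d) (s - d) = 1 - d\<^sup>2\<close>. Exchanging the two weights negates
  \<open>d\<close>, so the left side is the intertwiner back from the exchanged weight.\<close>

lemma intertwiner_intertwiner:
  "adj_swap i (intertwiner i a f) + fscale (1 / (a (Suc i) - a i)) (intertwiner i a f) =
   fscale (1 - (1 / (a (Suc i) - a i))\<^sup>2) f"
proof -
  define d where "d = 1 / (a (Suc i) - a i)"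
  show ?thesis
    unfolding intertwiner_def d_def[symmetric]
    by (simp add: adj_swap.diff adj_swap.scale) (simp add: pointwise algebra_simps power2_eq_square)
qed

lemma intertwiner_eq_0:
  assumes "\<bar>a i - a (Suc i)\<bar> \<noteq> 1" "intertwiner i a f = 0"
  shows "f = 0"
proof -
  have "fscale (1 - (1 / (a (Suc i) - a i))\<^sup>2) f = 0"
    using intertwiner_intertwiner[of i a f] by (simp add: assms(2) adj_swap.zero)
  \<comment> \<open>For equal values the quotient is 0 by convention, and the claim still
    holds.\<close>
  moreover have "(1 / (a (Suc i) - a i))\<^sup>2 \<noteq> 1"
  proof
    assume "(1 / (a (Suc i) - a i))\<^sup>2 = 1"
    then have "1 / (a (Suc i) - a i) = 1 \<or> 1 / (a (Suc i) - a i) = -1" by (simp add: power2_eq_1_iff)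
    then have "a (Suc i) - a i = 1 \<or> a (Suc i) - a i = -1"
      by (auto simp: divide_simps split: if_splits)
    with assms(1) show False by auto
  qed
  ultimately show ?thesis by simp
qed

text \<open>The image \<open>g\<close> of \<open>f\<close> under the intertwiner has the exchanged
  weight and is thus orthogonal to \<open>f\<close>. As now \<open>d\<^sup>2 = 1\<close>, the
  product formula makes \<open>g\<close> an eigenvector of the swap, and moving the swap across the
  inner product shows that \<open>g\<close> has norm zero.\<close>

lemma adj_swap_weight:
  assumes i: "1 \<le> i" "i < n" and f: "f \<in> weight_space n a" and diff: "\<bar>a i - a (Suc i)\<bar> = 1"
  shows "adj_swap i f = fscale (a (Suc i) - a i) f"
proof -
  have neq: "a i \<noteq> a (Suc i)" using diff by auto
  have d: "1 / (a (Suc i) - a i) = a (Suc i) - a i"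
  proof -
    have "a (Suc i) - a i = 1 \<or> a (Suc i) - a i = -1" using diff by auto
    then show ?thesis by (elim disjE) simp_all
  qed
  have d2: "(a (Suc i) - a i)\<^sup>2 = 1" using diff by (smt (verit) one_power2 power2_minus)
  let ?g = "intertwiner i a f"
  have g: "?g \<in> weight_space n (a \<circ> transpose i (Suc i))" by (rule intertwiner_weight_space[OF i f neq])
  have orth: "inprod (perms n) ?g f = 0"
    by (rule weight_space_orthogonal[OF g f, of i]) (use i neq in auto)
  have "adj_swap i ?g + fscale (a (Suc i) - a i) ?g = 0"
    using intertwiner_intertwiner[of i a f] unfolding d d2 by simp
  then have sw: "adj_swap i ?g = fscale (a i - a (Suc i)) ?g"
    by (simp add: pointwise algebra_simps)
  have "inprod (perms n) ?g ?g = inprod (perms n) ?g (adj_swap i f)"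
    by (subst (2) intertwiner_def) (simp add: inprod_simps orth)
  also have "\<dots> = inprod (perms n) (adj_swap i ?g) f" using inprod_adj_swap[OF i] by simp
  finally have "inprod (perms n) ?g ?g = 0" unfolding sw by (simp add: inprod_simps orth)
  then have "?g = 0" using g by (intro inprod_self_eq_0[of "perms n"]) (auto simp: weight_space_def)
  then show ?thesis unfolding intertwiner_def d by simp
qed

text \<open>Equal neighbouring values would give \<open>JM (Suc i)\<close> a Jordan block on
  \<open>f\<close> and \<open>adj_swap i f\<close>, impossible for a symmetric operator. In a
  pattern \<open>c, c + d, c\<close> with \<open>d = \<plusminus>1\<close>, the two adjacent swaps
  act by \<open>d\<close> and \<open>-d\<close>, which contradicts the braid relation.\<close>

lemma weights_content_family:
  assumes "n \<ge> 1"
  shows "content_family n {a. \<exists>f\<in>weight_space n a. f \<noteq> 0}"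
proof
  fix a :: "nat \<Rightarrow> real" assume "a \<in> {a. \<exists>f\<in>weight_space n a. f \<noteq> 0}"
  then obtain f where f: "f \<in> weight_space n a" "f \<noteq> 0" by blast
  have fG: "f \<in> fspace (perms n)" and fk: "\<And>k. k \<in> {1..n} \<Longrightarrow> JM k f = fscale (a k) f"
    using f by (auto simp: weight_space_def)
  have "fscale (a 1) f = 0" using fk[of 1] assms by (simp add: JM_def)
  then show "a 1 = 0" using f by simp
  {
    fix i assume i: "1 \<le> i" "i < n"
    show neq: "a i \<noteq> a (Suc i)"
    proof
      assume eq: "a i = a (Suc i)"
      let ?w = "adj_swap i f"
      have w: "JM (Suc i) ?w = fscale (a i) ?w + f"
        using JM_Suc_adj_swap[OF i(1)] fk[of i] i by (simp add: adj_swap.scale)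
      have "inprod (perms n) (JM (Suc i) ?w) f = inprod (perms n) ?w (JM (Suc i) f)"
        using i by (intro inprod_JM) auto
      then have "inprod (perms n) f f = 0"
        using fk[of "Suc i"] i unfolding w by (simp add: inprod_simps eq)
      then show False using inprod_self_eq_0[OF _ fG] f(2) by simp
    qed
    assume diff: "\<bar>a i - a (Suc i)\<bar> \<noteq> 1"
    show "a \<circ> transpose i (Suc i) \<in> {a. \<exists>f\<in>weight_space n a. f \<noteq> 0}"
      using intertwiner_weight_space[OF i f(1) neq] intertwiner_eq_0[OF diff, of f] f(2) by blast
  }
  fix i assume i: "1 \<le> i" "Suc i < n" and diff: "\<bar>a i - a (Suc i)\<bar> = 1"
  show "a (Suc (Suc i)) \<noteq> a i"
  proof
    assume eq: "a (Suc (Suc i)) = a i"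
    define d where "d = a (Suc i) - a i"
    have s1: "adj_swap i f = fscale d f"
      unfolding d_def using adj_swap_weight[OF _ _ f(1) diff] i by simp
    have s2: "adj_swap (Suc i) f = fscale (- d) f"
      using adj_swap_weight[OF _ _ f(1), of "Suc i"] diff i unfolding eq d_def
      by (simp add: abs_minus_commute)
    have "fscale (d * - d * d) f = fscale (- d * d * - d) f"
      using adj_swap_braid[of i f] by (simp only: s1 s2 adj_swap.scale fs.scale_scale)
    then have "d * - d * d = - d * d * - d" using f(2) fs.scale_right_imp_eq by blast
    then have "d = 0" by simp
    then show False using diff by (simp add: d_def)
  qed
qed

section \<open>Dimensions of weight spaces\<close>

text \<open>Evaluating a vanishing combination at \<open>pt i\<close> isolates the coefficient of
  \<open>F i\<close>.\<close>

lemma dual_points_independent: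
  fixes F :: "'i \<Rightarrow> 'a \<Rightarrow> real"
  assumes I: "finite I" and dual: "\<And>i j. i \<in> I \<Longrightarrow> j \<in> I \<Longrightarrow> F j (pt i) = of_bool (i = j)"
  shows "inj_on F I" "fs.independent (F ` I)"
proof -
  show inj: "inj_on F I"
  proof (rule inj_onI)
    fix i j assume ij: "i \<in> I" "j \<in> I" "F i = F j"
    then have "F i (pt i) = F j (pt i)" by simp
    then show "i = j" using dual[of i i] dual[of i j] ij by (simp split: if_splits)
  qed
  show "fs.independent (F ` I)"
  proof (rule fs.independent_if_scalars_zero)
    fix u g assume sum: "(\<Sum>g\<in>F ` I. fscale (u g) g) = 0" and "g \<in> F ` I"
    then obtain i where i: "i \<in> I" "g = F i" by blast
    have "0 = (\<Sum>g\<in>F ` I. fscale (u g) g) (pt i)" by (simp add: sum zero_fun_apply)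
    also have "\<dots> = (\<Sum>j\<in>I. u (F j) * F j (pt i))"
      by (simp add: sum.reindex[OF inj] sum_fun_apply fscale_apply)
    also have "\<dots> = (\<Sum>j\<in>I. if i = j then u (F j) else 0)"
      using dual i by (intro sum.cong) auto
    also have "\<dots> = u g" using i I by simp
    finally show "u g = 0" by simp
  qed (use I in simp)
qed

lemma dim_fspace:
  assumes "finite G"
  shows "fs.dim (fspace G) = card G"
proof -
  have "inj_on unit_fun G" "fs.independent (unit_fun ` G)"
    using dual_points_independent[OF assms, of unit_fun id] by (auto simp: unit_fun_def)
  moreover have "unit_fun ` G \<subseteq> fspace G" by (auto simp: unit_fun_def fspace_def)
  moreover have "fspace G \<subseteq> fs.span (unit_fun ` G)" using fspace_span_unit[OF assms] by blast
  ultimately show ?thesis using fs.basis_card_eq_dim card_image by metis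
qed

lemma fspace_independent_finite:
  assumes "finite G" "fs.independent B" "B \<subseteq> fspace G"
  shows "finite B"
  using fs.independent_span_bound[of "unit_fun ` G" B] fspace_span_unit[OF assms(1)] assms by blast

lemma dim_le_inj_linear:
  assumes G: "finite G" and W: "W \<subseteq> fspace G"
    and lin: "Vector_Spaces.linear fscale fscale \<phi>"
    and ker: "\<And>f. \<phi> f = 0 \<Longrightarrow> f = 0" and img: "\<And>f. f \<in> V \<Longrightarrow> \<phi> f \<in> W"
  shows "fs.dim V \<le> fs.dim W"
proof -
  interpret \<phi>: Vector_Spaces.linear fscale fscale \<phi> by (rule lin)
  have inj: "inj \<phi>"
  proof (rule injI)
    fix x y assume "\<phi> x = \<phi> y"
    then have "\<phi> (x - y) = 0" by (simp add: \<phi>.diff)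
    then show "x = y" using ker[of "x - y"] by simp
  qed
  obtain B where B: "B \<subseteq> V" "fs.independent B" "V \<subseteq> fs.span B" by (rule fs.maximal_independent_subset)
  obtain C where C: "C \<subseteq> W" "fs.independent C" "W \<subseteq> fs.span C" by (rule fs.maximal_independent_subset)
  have "fs.independent (\<phi> ` B)"
    using \<phi>.independent_injective_image[OF B(2)] inj by (meson inj_on_subset subset_UNIV)
  moreover have "finite C" using fspace_independent_finite[OF G C(2)] C(1) W by blast
  moreover have "\<phi> ` B \<subseteq> fs.span C" using B(1) C(3) img by blast
  ultimately have "card (\<phi> ` B) \<le> card C" using fs.independent_span_bound by blast
  moreover have "card (\<phi> ` B) = card B" using inj by (intro card_image) (meson inj_on_subset subset_UNIV)
  ultimately show ?thesis
    using fs.basis_card_eq_dim[OF B(1,3,2)] fs.basis_card_eq_dim[OF C(1,3,2)] by simp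
qed

lemma weight_space_subset: "weight_space n a \<subseteq> fspace (perms n)"
  by (auto simp: weight_space_def)

lemma dim_weight_space_swap_le:
  assumes "1 \<le> i" "i < n" "a i \<noteq> a (Suc i)" "\<bar>a i - a (Suc i)\<bar> \<noteq> 1"
  shows "fs.dim (weight_space n a) \<le> fs.dim (weight_space n (a \<circ> transpose i (Suc i)))"
  by (rule dim_le_inj_linear[OF finite_perms[of n] weight_space_subset linear_intertwiner[of i a] intertwiner_eq_0[OF assms(4)]])
    (use intertwiner_weight_space assms in auto)

lemma dim_weight_space_swap:
  assumes "1 \<le> i" "i < n" "a i \<noteq> a (Suc i)" "\<bar>a i - a (Suc i)\<bar> \<noteq> 1"
  shows "fs.dim (weight_space n (a \<circ> transpose i (Suc i))) = fs.dim (weight_space n a)"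
proof (rule antisym)
  let ?b = "a \<circ> transpose i (Suc i)"
  have "?b \<circ> transpose i (Suc i) = a" by (simp add: comp_assoc)
  moreover have "?b i \<noteq> ?b (Suc i)" "\<bar>?b i - ?b (Suc i)\<bar> \<noteq> 1" using assms by auto
  ultimately show "fs.dim (weight_space n ?b) \<le> fs.dim (weight_space n a)"
    using dim_weight_space_swap_le[OF assms(1,2), of ?b] by metis
qed (rule dim_weight_space_swap_le[OF assms])

text \<open>The entry -2 is moved to the end before -1 follows, because these two differ by one and
  could not be exchanged with each other. Every entry passed has positive content, as
  \<open>p \<ge> 2\<close>, so it differs by at least two and each exchange preserves the
  dimension.\<close>

lemma dim_hook_weight_space:
  assumes "2 \<le> p" "p < q" "q \<le> n"
  shows "fs.dim (weight_space n (hook_content p q)) = fs.dim (weight_space n (hook_content (n - 1) n))"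
proof -
  have right: "hook_content p q = hook_content p (Suc q) \<circ> transpose q (Suc q)" if "p < q" for p q
    using that by (auto simp: fun_eq_iff hook_content_def transpose_def of_bool_def)
  have left: "hook_content p q = hook_content (Suc p) q \<circ> transpose p (Suc p)" if "Suc p < q" for p q
    using that by (auto simp: fun_eq_iff hook_content_def transpose_def of_bool_def)
  have "fs.dim (weight_space n (hook_content p q)) = fs.dim (weight_space n (hook_content p n))"
    using assms(3,2)
  proof (induction q rule: inc_induct)
    case (step q)
    have "fs.dim (weight_space n (hook_content p q)) = fs.dim (weight_space n (hook_content p (Suc q)))"
      using step(2,4) assms(1) unfolding right[OF step(4)]
      by (intro dim_weight_space_swap) (auto simp: hook_content_def of_bool_def)
    with step show ?case by simp
  qed simp
  also have "p \<le> n - 1" using assms by simp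
  then have "fs.dim (weight_space n (hook_content p n)) = fs.dim (weight_space n (hook_content (n - 1) n))"
    using assms(1)
  proof (induction p rule: inc_induct)
    case (step p)
    then have less: "Suc p < n" by simp
    have "fs.dim (weight_space n (hook_content p n)) = fs.dim (weight_space n (hook_content (Suc p) n))"
      using step(4) less unfolding left[OF less]
      by (intro dim_weight_space_swap) (auto simp: hook_content_def of_bool_def)
    with step show ?case by simp
  qed simp
  finally show ?thesis .
qed

text \<open>Any basis of joint eigenvectors is automatically adapted: different weights are
  orthogonal, so for \<open>f\<close> in a weight space the part of its expansion outside that space
  is orthogonal to itself.\<close>

lemma weight_basis_exists:
  obtains B where "B \<subseteq> (\<Union>a. weight_space n a)" "fs.independent B" "fspace (perms n) \<subseteq> fs.span B"
    "finite B" "card B = card (perms n)"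
    "\<forall>a. card (B \<inter> weight_space n a) = fs.dim (weight_space n a)"
proof -
  let ?E = "{g \<in> fspace (perms n). \<forall>k\<in>{1..n}. \<exists>c. JM k g = fscale c g}"
  have E: "?E \<subseteq> (\<Union>a. weight_space n a)"
  proof
    fix g assume g: "g \<in> ?E"
    then have "\<forall>k\<in>{1..n}. \<exists>c. JM k g = fscale c g" by blast
    from bchoice[OF this] obtain a where "\<forall>k\<in>{1..n}. JM k g = fscale (a k) g" by blast
    then have "g \<in> weight_space n a" using g by (simp add: weight_space_def)
    then show "g \<in> (\<Union>a. weight_space n a)" by blast
  qed
  obtain B where B: "B \<subseteq> ?E" "fs.independent B" "?E \<subseteq> fs.span B" by (rule fs.maximal_independent_subset)
  have "f \<in> fs.span ?E" if "f \<in> fspace (perms n)" for f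
    by (rule joint_eigenvectors_span[OF finite_perms linear_JM JM_fspace inprod_JM JM_JM_commute that])
  moreover have "fs.span ?E \<subseteq> fs.span B" using B(3) by (rule fs.span_minimal) simp
  ultimately have span: "fspace (perms n) \<subseteq> fs.span B" by blast
  have BG: "B \<subseteq> fspace (perms n)" using B(1) by blast
  have fin: "finite B" using fspace_independent_finite[OF finite_perms B(2) BG] .
  have card: "card B = card (perms n)"
    using fs.basis_card_eq_dim[OF BG span B(2)] dim_fspace[OF finite_perms[of n]] by simp
  have dims: "card (B \<inter> weight_space n a) = fs.dim (weight_space n a)" for a
  proof (rule fs.basis_card_eq_dim)
    show "fs.independent (B \<inter> weight_space n a)" using B(2) fs.independent_mono by blast
    show "weight_space n a \<subseteq> fs.span (B \<inter> weight_space n a)"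
    proof
      fix f assume f: "f \<in> weight_space n a"
      let ?W = "weight_space n a"
      have "f \<in> fs.span B" using f span weight_space_subset by blast
      then obtain u where u: "f = (\<Sum>b\<in>B. fscale (u b) b)" using fs.span_finite[OF fin] by auto
      define f1 where "f1 = (\<Sum>b\<in>B \<inter> ?W. fscale (u b) b)"
      define f2 where "f2 = (\<Sum>b\<in>B - ?W. fscale (u b) b)"
      have f12: "f - f1 = f2"
        unfolding u f1_def f2_def using sum.Int_Diff[OF fin, of "\<lambda>b. fscale (u b) b" ?W] by simp
      have f1: "f1 \<in> ?W"
        unfolding f1_def by (intro fs.subspace_sum subspace_weight_space fs.subspace_scale) auto
      have d: "f - f1 \<in> ?W" using f f1 fs.subspace_diff[OF subspace_weight_space] by blast
      have "inprod (perms n) b (f - f1) = 0" if b: "b \<in> B - ?W" for b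
      proof -
        obtain c where c: "b \<in> weight_space n c" using b B(1) E by blast
        then obtain k where "k \<in> {1..n}" "c k \<noteq> a k" using b weight_space_cong[of n c a] by blast
        then show ?thesis using weight_space_orthogonal[OF c d] by blast
      qed
      then have "inprod (perms n) f2 (f - f1) = 0"
        unfolding f2_def by (simp add: inprod_sum inprod_simps)
      then have "f - f1 = 0"
        using inprod_self_eq_0[OF finite_perms[of n], of "f - f1"] d weight_space_subset f12 by auto
      then have "f = f1" by simp
      also have "f1 \<in> fs.span (B \<inter> ?W)"
        unfolding f1_def by (intro fs.span_sum fs.span_scale fs.span_base)
      finally show "f \<in> fs.span (B \<inter> ?W)" .
    qed
  qed simp
  show ?thesis by (rule that[OF subset_trans[OF B(1) E] B(2) span fin card]) (use dims in blast)
qed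

lemma card_pairs:
  fixes S :: "nat set"
  assumes "finite S"
  shows "card {(p, q). p \<in> S \<and> q \<in> S \<and> p < q} = card S choose 2"
  using assms
proof (induction S rule: finite_linorder_max_induct)
  case (insert b S)
  have "{(p, q). p \<in> insert b S \<and> q \<in> insert b S \<and> p < q} =
      {(p, q). p \<in> S \<and> q \<in> S \<and> p < q} \<union> (\<lambda>p. (p, b)) ` S"
    using insert.hyps by auto
  moreover have "finite {(p, q). p \<in> S \<and> q \<in> S \<and> p < q}"
    by (rule finite_subset[of _ "S \<times> S"]) (use insert.hyps in auto)
  moreover have "{(p, q). p \<in> S \<and> q \<in> S \<and> p < q} \<inter> (\<lambda>p. (p, b)) ` S = {}"
    using insert.hyps by auto
  moreover have "card ((\<lambda>p. (p, b)) ` S) = card S" by (intro card_image) (auto simp: inj_on_def)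
  moreover have "b \<notin> S" using insert.hyps by auto
  ultimately show ?case using insert by (simp add: card_Un_disjoint numeral_2_eq_2)
qed simp

section \<open>Functions of the last two values\<close>

definition two_point :: "nat \<Rightarrow> (nat \<Rightarrow> nat \<Rightarrow> real) \<Rightarrow> (nat \<Rightarrow> nat) \<Rightarrow> real" where
  "two_point n h = (\<lambda>x. if x \<in> perms n then h (x (n - 1)) (x n) else 0)"

text \<open>Contents of a tableau with \<open>1, ..., n - 2\<close> in the first row; \<alpha> and
  \<beta> are the contents of the boxes of \<open>n - 1\<close> and \<open>n\<close>.\<close>

definition two_point_weight :: "nat \<Rightarrow> real \<Rightarrow> real \<Rightarrow> nat \<Rightarrow> real" where
  "two_point_weight n \<alpha> \<beta> k = (if k = n then \<beta> else if k = n - 1 then \<alpha> else real k - 1)"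

lemma two_point_fspace: "two_point n h \<in> fspace (perms n)"
  by (simp add: fspace_def two_point_def)

lemma perms_transpose:
  "x \<in> perms n \<Longrightarrow> i \<in> {1..n} \<Longrightarrow> j \<in> {1..n} \<Longrightarrow> x \<circ> transpose i j \<in> perms n"
  by (simp add: perms_def comp_permutes_iff permutes_swap_id)

lemma sum_perms:
  assumes "x \<in> perms n"
  shows "(\<Sum>i=1..n. h (x i)) = (\<Sum>c=1..n. h c :: real)"
  using sum.permute[of x "{1..n}" h] assms by (simp add: perms_def o_def)

text \<open>The operators sum over the first positions only, but \<open>x\<close> is a bijection, so
  these sums become full row and column sums of \<open>h\<close> with the two last positions
  removed. The zero diagonal removes one of the two correction terms.\<close>

lemma JM_two_point:
  assumes n: "n \<ge> 2" and diag: "\<And>c. c \<in> {1..n} \<Longrightarrow> h c c = 0" and x: "x \<in> perms n"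
  defines "a \<equiv> x (n - 1)" and "b \<equiv> x n"
  shows "k \<in> {1..n} \<Longrightarrow> k < n - 1 \<Longrightarrow> JM k (two_point n h) x = (real k - 1) * h a b"
    and "JM (n - 1) (two_point n h) x = (\<Sum>c=1..n. h c b) - h a b"
    and "JM n (two_point n h) x = (\<Sum>c=1..n. h a c) - h a b + h b a"
proof -
  define m where "m = n - 2"
  have m: "n = Suc (Suc m)" using n by (simp add: m_def)
  have ab: "a \<in> {1..n}" "b \<in> {1..n}"
    using permutes_in_image[of x "{1..n}"] x m by (auto simp: a_def b_def perms_def)
  have split: "(\<Sum>i=1..n. g i) = (\<Sum>i=1..m. g i) + g (n - 1) + g n" for g :: "nat \<Rightarrow> real" by (simp add: m)
  have iv: "{1..<n - 1} = {1..m}" using m by auto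
  have iv': "(\<Sum>i=1..<n. g i) = (\<Sum>i=1..m. g i) + g (n - 1)" for g :: "nat \<Rightarrow> real"
    by (simp add: m atLeastLessThanSuc_atLeastAtMost)
  show "JM k (two_point n h) x = (real k - 1) * h a b" if k: "k \<in> {1..n}" "k < n - 1"
  proof -
    have "JM k (two_point n h) x = (\<Sum>i=1..<k. h a b)"
      unfolding JM_apply
    proof (rule sum.cong[OF refl])
      fix i assume "i \<in> {1..<k}"
      then show "two_point n h (x \<circ> transpose i k) = h a b"
        using k perms_transpose[OF x, of i k] by (auto simp: two_point_def a_def b_def transpose_def)
    qed
    then show ?thesis using k by (simp add: of_nat_diff)
  qed
  have "JM (n - 1) (two_point n h) x = (\<Sum>i=1..m. h (x i) b)"
    unfolding JM_apply iv
  proof (rule sum.cong[OF refl])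
    fix i assume "i \<in> {1..m}"
    then show "two_point n h (x \<circ> transpose i (n - 1)) = h (x i) b"
      using m perms_transpose[OF x, of i "n - 1"] by (auto simp: two_point_def b_def transpose_def)
  qed
  also have "\<dots> = (\<Sum>i=1..n. h (x i) b) - h a b"
    unfolding split using diag ab by (simp add: a_def b_def)
  finally show "JM (n - 1) (two_point n h) x = (\<Sum>c=1..n. h c b) - h a b"
    using sum_perms[OF x, of "\<lambda>c. h c b"] by simp
  have "JM n (two_point n h) x = (\<Sum>i=1..m. h a (x i)) + h b a"
    unfolding JM_apply iv'
  proof (intro arg_cong2[of _ _ _ _ "(+)"] sum.cong refl)
    fix i assume "i \<in> {1..m}"
    then show "two_point n h (x \<circ> transpose i n) = h a (x i)"
      using m perms_transpose[OF x, of i n] by (auto simp: two_point_def a_def transpose_def)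
  next
    show "two_point n h (x \<circ> transpose (n - 1) n) = h b a"
      using m perms_transpose[OF x, of "n - 1" n] by (auto simp: two_point_def a_def b_def transpose_def)
  qed
  also have "(\<Sum>i=1..m. h a (x i)) = (\<Sum>i=1..n. h a (x i)) - h a b"
    unfolding split using diag ab by (simp add: a_def b_def)
  finally show "JM n (two_point n h) x = (\<Sum>c=1..n. h a c) - h a b + h b a"
    using sum_perms[OF x, of "h a"] by simp
qed

lemma two_point_weight_spaceI:
  assumes n: "n \<ge> 2" and diag: "\<And>c. c \<in> {1..n} \<Longrightarrow> h c c = 0"
    and col: "\<And>a b. a \<in> {1..n} \<Longrightarrow> b \<in> {1..n} \<Longrightarrow> a \<noteq> b \<Longrightarrow> (\<Sum>c=1..n. h c b) - h a b = \<alpha> * h a b"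
    and row: "\<And>a b. a \<in> {1..n} \<Longrightarrow> b \<in> {1..n} \<Longrightarrow> a \<noteq> b \<Longrightarrow> (\<Sum>c=1..n. h a c) - h a b + h b a = \<beta> * h a b"
  shows "two_point n h \<in> weight_space n (two_point_weight n \<alpha> \<beta>)"
proof -
  have "JM k (two_point n h) x = two_point_weight n \<alpha> \<beta> k * two_point n h x" if k: "k \<in> {1..n}" for k x
  proof (cases "x \<in> perms n")
    case False
    then show ?thesis using JM_fspace[OF k two_point_fspace, of h] two_point_fspace[of n h]
      by (simp add: fspace_def)
  next
    case True
    let ?a = "x (n - 1)" and ?b = "x n"
    have ab: "?a \<in> {1..n}" "?b \<in> {1..n}" "?a \<noteq> ?b"
      using permutes_in_image[of x "{1..n}"] permutes_inj[of x "{1..n}"] True n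
      by (auto simp: perms_def inj_eq)
    consider "k = n" | "k = n - 1" "k \<noteq> n" | "k < n - 1" using k by force
    then show ?thesis
      using JM_two_point[where n = n and h = h and x = x, OF n diag True] k col[OF ab] row[OF ab] True
      by cases (auto simp: two_point_weight_def two_point_def)
  qed
  then show ?thesis by (simp add: weight_space_def two_point_fspace fun_eq_iff fscale_apply)
qed

text \<open>The inner transposition sends \<open>n - 1\<close> to the point that the outer one maps
  to \<open>a\<close>. It fixes \<open>n\<close> when \<open>a \<noteq> b\<close>, and the outer one
  then sends \<open>n\<close> to \<open>b\<close>.\<close>

definition perm_with_values :: "nat \<Rightarrow> nat \<Rightarrow> nat \<Rightarrow> nat \<Rightarrow> nat" where
  "perm_with_values n a b = transpose n b \<circ> transpose (n - 1) (transpose n b a)"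

lemma perm_with_values:
  assumes "n \<ge> 2" "a \<in> {1..n}" "b \<in> {1..n}" "a \<noteq> b"
  shows "perm_with_values n a b \<in> perms n" "perm_with_values n a b (n - 1) = a"
    "perm_with_values n a b n = b"
proof -
  have "transpose n b a \<in> {1..n}" using assms by (auto simp: transpose_def)
  then show "perm_with_values n a b \<in> perms n"
    unfolding perm_with_values_def perms_def mem_Collect_eq
    by (intro permutes_compose permutes_swap_id) (use assms in auto)
  show "perm_with_values n a b (n - 1) = a" "perm_with_values n a b n = b"
    using assms by (auto simp: perm_with_values_def transpose_def)
qed

text \<open>Contents increase by one along \<open>1, ..., m\<close>, so each adjacent swap there
  acts as the identity on \<open>f\<close>, and these swaps generate the symmetric group of
  \<open>{1..m}\<close>.\<close>

lemma weight_space_row_invariant: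
  assumes f: "f \<in> weight_space n a" and m: "m \<le> n" and row: "\<And>k. k \<in> {1..m} \<Longrightarrow> a k = real k - 1"
    and s: "s permutes {1..m}"
  shows "f (x \<circ> s) = f x"
proof -
  have adj: "f (x \<circ> transpose i (Suc i)) = f x" if i: "1 \<le> i" "Suc i \<le> m" for i x
  proof -
    have "adj_swap i f = fscale 1 f"
      using adj_swap_weight[OF _ _ f, of i] i m row[of i] row[of "Suc i"] by simp
    then have "adj_swap i f x = f x" by simp
    then show ?thesis by (simp add: adj_swap_def rtrans_def)
  qed
  have transp: "f (x \<circ> transpose i k) = f x" if "1 \<le> i" "i < k" "k \<le> m" for i k x
    using that
  proof (induction k arbitrary: x)
    case (Suc k)
    show ?case
    proof (cases "i = k")
      case True
      then show ?thesis using adj[of k x] Suc.prems by blast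
    next
      case False
      have "transpose i (Suc k) = transpose k (Suc k) \<circ> transpose i k \<circ> transpose k (Suc k)"
        using Suc.prems False by (auto simp: fun_eq_iff transpose_def)
      then have "f (x \<circ> transpose i (Suc k)) = f (((x \<circ> transpose k (Suc k)) \<circ> transpose i k) \<circ> transpose k (Suc k))"
        by (simp add: comp_assoc)
      also have "\<dots> = f ((x \<circ> transpose k (Suc k)) \<circ> transpose i k)"
        by (rule adj) (use Suc.prems in auto)
      also have "\<dots> = f (x \<circ> transpose k (Suc k))"
        by (rule Suc.IH) (use Suc.prems False in auto)
      also have "\<dots> = f x"
        by (rule adj) (use Suc.prems False in auto)
      finally show ?thesis .
    qed
  qed simp
  have transp': "f (x \<circ> transpose i k) = f x" if "i \<in> {1..m}" "k \<in> {1..m}" "i \<noteq> k" for i k x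
    using that transp[of i k x] transp[of k i x] transpose_commute[of i k]
    by (cases i k rule: linorder_cases) auto
  have "\<forall>x. f (x \<circ> s) = f x"
    using s finite_atLeastAtMost
  proof (induction s rule: permutes_induct)
    case (swap i k s)
    have "f (x \<circ> (transpose i k \<circ> s)) = f x" for x
      using swap.IH transp'[OF swap.hyps(1-3)] by (metis comp_assoc)
    then show ?case ..
  qed simp
  then show ?thesis ..
qed

text \<open>Two permutations with the same last two values differ by a right factor that permutes
  \<open>{1..n - 2}\<close>, under which \<open>f\<close> is invariant; \<open>g\<close> reads
  \<open>f\<close> off at one representative.\<close>

lemma weight_space_two_point:
  assumes f: "f \<in> weight_space n a" and n: "n \<ge> 2"
    and row: "\<And>k. k \<in> {1..n - 2} \<Longrightarrow> a k = real k - 1"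
  obtains g where "f = two_point n g" "\<And>c. g c c = 0"
proof
  define g where "g c d = (if c = d then 0 else f (perm_with_values n c d))" for c d
  show "g c c = 0" for c by (simp add: g_def)
  show "f = two_point n g"
  proof
    fix x
    show "f x = two_point n g x"
    proof (cases "x \<in> perms n")
      case False
      then show ?thesis using f by (auto simp: weight_space_def fspace_def two_point_def)
    next
      case x: True
      let ?a = "x (n - 1)" and ?b = "x n"
      have ab: "?a \<in> {1..n}" "?b \<in> {1..n}" "?a \<noteq> ?b"
        using permutes_in_image[of x "{1..n}"] permutes_inj[of x "{1..n}"] x n
        by (auto simp: perms_def inj_eq)
      define y where "y = perm_with_values n ?a ?b"
      note y = perm_with_values[OF n ab, folded y_def]
      have xp: "x permutes {1..n}" and yp: "y permutes {1..n}" using x y by (auto simp: perms_def)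
      define s where "s = Hilbert_Choice.inv x \<circ> y"
      have sn: "s permutes {1..n}" unfolding s_def using xp yp by (intro permutes_compose permutes_inv)
      have "s permutes {1..n - 2}"
      proof (rule permutes_superset[OF sn])
        fix i assume i: "i \<in> {1..n} - {1..n - 2}"
        then consider "i = n - 1" | "i = n" by force
        then show "s i = i" using y permutes_inverses(2)[OF xp] by cases (auto simp: s_def)
      qed
      moreover have "x \<circ> s = y"
        by (simp add: s_def o_assoc permutes_inv_o[OF xp])
      ultimately have "f y = f x"
        using weight_space_row_invariant[OF f _ row, of "n - 2" s x] n by auto
      then show ?thesis using x ab(3) by (simp add: two_point_def g_def y_def)
    qed
  qed
qed

lemma hook_content_last: "k \<le> n \<Longrightarrow> n \<ge> 2 \<Longrightarrow> hook_content (n - 1) n k = two_point_weight n (-1) (-2) k"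
  by (auto simp: hook_content_def two_point_weight_def)

text \<open>Eigenvalue -1 of \<open>JM (n - 1)\<close> makes all column sums vanish. Eigenvalue -2
  of \<open>JM n\<close> gives \<open>row a = - (g a b + g b a)\<close>, which is symmetric in
  \<open>a\<close> and \<open>b\<close>; hence all row sums are equal, and they vanish because their
  total is that of the columns.\<close>

lemma hook_weight_space_antisym:
  assumes f: "f \<in> weight_space n (hook_content (n - 1) n)" and n: "n \<ge> 3"
  obtains g where "f = two_point n g"
    "\<And>a b. a \<in> {1..n} \<Longrightarrow> b \<in> {1..n} \<Longrightarrow> g b a = - g a b"
    "\<And>a. a \<in> {1..n} \<Longrightarrow> (\<Sum>c=1..n. g a c) = 0"
proof -
  have n2: "n \<ge> 2" using n by simp
  obtain g where g: "f = two_point n g" and diag: "\<And>c. g c c = 0"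
  proof (rule weight_space_two_point[OF f n2])
    show "hook_content (n - 1) n k = real k - 1" if "k \<in> {1..n - 2}" for k
      using that by (auto simp: hook_content_def)
  qed blast
  have JMf: "JM k (two_point n g) x = hook_content (n - 1) n k * two_point n g x" if "k \<in> {1..n}" for k x
    using f that by (simp add: weight_space_def g fscale_apply)
  define row where "row a = (\<Sum>c=1..n. g a c)" for a
  define col where "col b = (\<Sum>c=1..n. g c b)" for b
  have eqs: "col b = 0" "row a = - (g a b + g b a)"
    if ab: "a \<in> {1..n}" "b \<in> {1..n}" "a \<noteq> b" for a b
  proof -
    note x = perm_with_values[OF n2 ab]
    have val: "two_point n g (perm_with_values n a b) = g a b" using x by (simp add: two_point_def)
    have n1: "n - 1 \<in> {1..n}" and nn: "n \<in> {1..n}" and nn1: "n \<noteq> n - 1" using n by auto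
    have "col b - g a b = - g a b"
      using JM_two_point(2)[where h = g, OF n2 diag x(1)] JMf[OF n1, of "perm_with_values n a b"]
      unfolding val x by (simp add: col_def hook_content_def)
    then show "col b = 0" by simp
    have "row a - g a b + g b a = - 2 * g a b"
      using JM_two_point(3)[where h = g, OF n2 diag x(1)] JMf[OF nn, of "perm_with_values n a b"] nn1
      unfolding val x by (simp add: row_def hook_content_def)
    then show "row a = - (g a b + g b a)" by simp
  qed
  have row1: "row a = row 1" if "a \<in> {1..n}" for a
    using eqs(2)[of a 1] eqs(2)[of 1 a] that n by (cases "a = 1") auto
  have "(\<Sum>a=1..n. row a) = (\<Sum>a=1..n. row 1)" by (intro sum.cong refl row1)
  then have "(\<Sum>a=1..n. row a) = real n * row 1" by simp
  moreover have "(\<Sum>a=1..n. row a) = (\<Sum>b=1..n. col b)"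
    unfolding row_def col_def by (rule sum.swap)
  moreover have "col b = 0" if "b \<in> {1..n}" for b
    using eqs(1)[of "if b = 1 then 2 else 1" b] that n by auto
  ultimately have "row 1 = 0" using n by simp
  then have row0: "row a = 0" if "a \<in> {1..n}" for a
    using row1[OF that] by simp
  show ?thesis
  proof (rule that[OF g])
    show "(\<Sum>c=1..n. g a c) = 0" if "a \<in> {1..n}" for a using row0[OF that] by (simp add: row_def)
    show "g b a = - g a b" if "a \<in> {1..n}" "b \<in> {1..n}" for a b
      using eqs(2)[OF that] row0[OF that(1)] diag by (cases "a = b") auto
  qed
qed

definition root_vec :: "nat \<Rightarrow> nat \<Rightarrow> nat \<Rightarrow> real" where
  "root_vec p q c = of_bool (c = p) - of_bool (c = q)"

lemma sum_root_vec:
  assumes "p \<in> {1..n}" "q \<in> {1..n}"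
  shows "(\<Sum>c=1..n. root_vec p q c) = 0"
  using assms by (simp add: root_vec_def sum_subtractf of_bool_def)

text \<open>The space is the exterior square of the vectors of sum zero. Its basis consists of the
  wedge products of the roots \<open>e_p - e_n\<close> and \<open>e_q - e_n\<close> with
  \<open>p < q < n\<close>, dual to evaluation at the entries \<open>(p, q)\<close>. An element
  vanishing at these entries is zero: antisymmetry covers all entries below \<open>n\<close>, and
  the row sums force the rest.\<close>

lemma dim_hook_last:
  assumes n: "n \<ge> 3"
  shows "fs.dim (weight_space n (hook_content (n - 1) n)) = (n - 1) choose 2"
proof -
  have n2: "n \<ge> 2" using n by simp
  let ?W = "weight_space n (hook_content (n - 1) n)"
  define I where "I = {(p, q). p \<in> {1..n - 1} \<and> q \<in> {1..n - 1} \<and> p < q}"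
  have cardI: "card I = (n - 1) choose 2" unfolding I_def using card_pairs[of "{1..n - 1}"] by simp
  have finI: "finite I" by (rule finite_subset[of _ "{1..n - 1} \<times> {1..n - 1}"]) (auto simp: I_def)
  define h where "h = (\<lambda>(p, q) a b. root_vec p n a * root_vec q n b - root_vec q n a * root_vec p n b)"
  define F where "F i = two_point n (h i)" for i
  define pt where "pt = (\<lambda>(a, b). perm_with_values n a b)"
  have ptI: "pt i \<in> perms n" "pt i (n - 1) = fst i" "pt i n = snd i" if "i \<in> I" for i
    using that perm_with_values[OF n2, of "fst i" "snd i"] by (auto simp: I_def pt_def)
  have FW: "F i \<in> ?W" if i: "i \<in> I" for i
  proof -
    obtain p q where pq: "i = (p, q)" "p \<in> {1..n}" "q \<in> {1..n}" "n \<in> {1..n}" using i n by (auto simp: I_def)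
    have row: "(\<Sum>c=1..n. h i a c) = 0" for a
      unfolding pq(1) h_def using sum_root_vec[OF pq(2,4)] sum_root_vec[OF pq(3,4)]
      by (simp add: sum_subtractf sum_distrib_left[symmetric])
    have col: "(\<Sum>c=1..n. h i c b) = 0" for b
      unfolding pq(1) h_def using sum_root_vec[OF pq(2,4)] sum_root_vec[OF pq(3,4)]
      by (simp add: sum_subtractf sum_distrib_right[symmetric])
    have anti: "h i b a = - h i a b" for a b unfolding pq(1) h_def by simp
    have "F i \<in> weight_space n (two_point_weight n (-1) (-2))"
      unfolding F_def by (rule two_point_weight_spaceI[OF n2]) (use row col anti in \<open>auto simp: h_def pq\<close>)
    also have "\<dots> = ?W" using hook_content_last[of _ n] n2 by (intro weight_space_cong) auto
    finally show ?thesis .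
  qed
  have dual: "F j (pt i) = of_bool (i = j)" if "i \<in> I" "j \<in> I" for i j
    using that ptI[OF that(1)]
    by (cases i; cases j) (auto simp: F_def two_point_def h_def root_vec_def I_def)
  note indep = dual_points_independent[OF finI, of F pt, OF dual]
  have "?W \<subseteq> fs.span (F ` I)"
  proof
    fix f assume f: "f \<in> ?W"
    define f' where "f' = f - (\<Sum>i\<in>I. fscale (f (pt i)) (F i))"
    have f'W: "f' \<in> ?W" unfolding f'_def
      by (intro fs.subspace_diff fs.subspace_sum fs.subspace_scale subspace_weight_space f FW)
    have zero: "f' (pt i) = 0" if i: "i \<in> I" for i
    proof -
      have "(\<Sum>j\<in>I. f (pt j) * F j (pt i)) = (\<Sum>j\<in>I. if i = j then f (pt j) else 0)"
        using dual[OF i] by (intro sum.cong) auto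
      then show ?thesis unfolding f'_def
        using i finI by (simp add: minus_apply sum_fun_apply fscale_apply)
    qed
    obtain g where g: "f' = two_point n g"
      and anti: "\<And>a b. a \<in> {1..n} \<Longrightarrow> b \<in> {1..n} \<Longrightarrow> g b a = - g a b"
      and row: "\<And>a. a \<in> {1..n} \<Longrightarrow> (\<Sum>c=1..n. g a c) = 0"
      using hook_weight_space_antisym[OF f'W n] by blast
    have lt: "g a b = 0" if "(a, b) \<in> I" for a b
      using zero[OF that] ptI[OF that] by (simp add: g two_point_def)
    have inner: "g a b = 0" if "a \<in> {1..n - 1}" "b \<in> {1..n - 1}" for a b
      using that lt[of a b] lt[of b a] anti[of a b] anti[of a a]
      by (cases a b rule: linorder_cases) (auto simp: I_def)
    have last: "g a n = 0" if a: "a \<in> {1..n - 1}" for a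
    proof -
      have "(\<Sum>c=1..n. g a c) = (\<Sum>c=1..n - 1. g a c) + g a n"
        using n by (cases n) auto
      also have "(\<Sum>c=1..n - 1. g a c) = 0" using inner[OF a] by simp
      finally show ?thesis using row[of a] a by auto
    qed
    have "g a b = 0" if "a \<in> {1..n}" "b \<in> {1..n}" for a b
    proof -
      have "a \<in> {1..n - 1} \<or> a = n" "b \<in> {1..n - 1} \<or> b = n" using that by auto
      then show ?thesis using inner[of a b] last[of a] last[of b] anti[of n b] anti[of n n] that by fastforce
    qed
    moreover have "x (n - 1) \<in> {1..n}" "x n \<in> {1..n}" if "x \<in> perms n" for x
      using that n permutes_in_image[of x "{1..n}"] by (auto simp: perms_def)
    ultimately have "f' = 0"
      unfolding g two_point_def by (simp add: fun_eq_iff zero_fun_apply)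
    then have "f = (\<Sum>i\<in>I. fscale (f (pt i)) (F i))" by (simp add: f'_def)
    also have "\<dots> \<in> fs.span (F ` I)" by (intro fs.span_sum fs.span_scale fs.span_base) auto
    finally show "f \<in> fs.span (F ` I)" .
  qed
  then have "card (F ` I) = fs.dim ?W" using FW indep(2) by (intro fs.basis_card_eq_dim) auto
  then show ?thesis using card_image[OF indep(1)] cardI by simp
qed

section \<open>Occurrence of the three larger eigenvalues\<close>

text \<open>One nonzero vector for each of the shapes (n), (n-1,1) and (n-2,2): the constant
  function, a function of \<open>x n\<close> alone with sum zero, and a symmetrised product of two
  roots.\<close>

lemma largest_weights_exist:
  assumes n: "n \<ge> 4"
  shows "\<exists>f\<in>weight_space n (two_point_weight n (real n - 2) (real n - 1)). f \<noteq> 0" (is ?A)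
    and "\<exists>f\<in>weight_space n (two_point_weight n (real n - 2) (-1)). f \<noteq> 0" (is ?B)
    and "\<exists>f\<in>weight_space n (two_point_weight n (-1) 0). f \<noteq> 0" (is ?C)
proof -
  have n2: "n \<ge> 2" using n by simp
  have nz: "two_point n h \<noteq> 0" if "h 1 2 \<noteq> 0" for h
  proof
    assume "two_point n h = 0"
    then have "two_point n h (perm_with_values n 1 2) = 0" by (simp add: zero_fun_apply)
    then show False using perm_with_values[OF n2, of 1 2] n that by (simp add: two_point_def)
  qed
  have offdiag: "(\<Sum>c=1..n. if c = b then 0 else v c) = (\<Sum>c=1..n. v c) - v b"
    if "b \<in> {1..n}" for b and v :: "nat \<Rightarrow> real"
  proof -
    have "(\<Sum>c=1..n. if c = b then 0 else v c) = (\<Sum>c=1..n. v c - (if c = b then v c else 0))"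
      by (intro sum.cong) auto
    then show ?thesis using that by (simp add: sum_subtractf)
  qed
  let ?h = "\<lambda>v a b :: nat. if a = b then 0 else v b :: real"
  have col: "(\<Sum>c=1..n. ?h v c b) = (real n - 1) * v b" if "b \<in> {1..n}" for v b
    using offdiag[OF that, of "\<lambda>_. v b"] by (simp add: algebra_simps)
  have row: "(\<Sum>c=1..n. ?h v a c) = (\<Sum>c=1..n. v c) - v a" if "a \<in> {1..n}" for v a
  proof -
    have "(\<Sum>c=1..n. ?h v a c) = (\<Sum>c=1..n. if c = a then 0 else v c)" by (intro sum.cong) auto
    then show ?thesis using offdiag[OF that, of v] by simp
  qed
  have weight: "two_point n (?h v) \<in> weight_space n (two_point_weight n (real n - 2) \<beta>)"
    if v: "\<And>b. (\<Sum>c=1..n. v c) - v b = \<beta> * v b" for v \<beta>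
  proof (rule two_point_weight_spaceI[OF n2])
    fix a b assume ab: "a \<in> {1..n}" "b \<in> {1..n}" "a \<noteq> b"
    show "(\<Sum>c=1..n. ?h v c b) - ?h v a b = (real n - 2) * ?h v a b"
      unfolding col[OF ab(2)] using ab by (simp add: algebra_simps)
    show "(\<Sum>c=1..n. ?h v a c) - ?h v a b + ?h v b a = \<beta> * ?h v a b"
      unfolding row[OF ab(1)] using ab v[of b] by simp
  qed simp
  have "two_point n (?h (\<lambda>_. 1)) \<in> weight_space n (two_point_weight n (real n - 2) (real n - 1))"
    by (rule weight) simp
  moreover have "two_point n (?h (\<lambda>_. 1)) \<noteq> 0" by (rule nz) simp
  ultimately show ?A by blast
  have "two_point n (?h (root_vec 1 2)) \<in> weight_space n (two_point_weight n (real n - 2) (-1))"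
    by (rule weight) (use sum_root_vec[of 1 n 2] n in simp)
  moreover have "two_point n (?h (root_vec 1 2)) \<noteq> 0" by (rule nz) (simp add: root_vec_def)
  ultimately show ?B by blast
  \<comment> \<open>The roots have disjoint supports, so the diagonal of \<open>k\<close> vanishes;
    this takes four points.\<close>
  define k where "k a b = root_vec 1 3 a * root_vec 2 4 b + root_vec 2 4 a * root_vec 1 3 b" for a b
  have s: "(\<Sum>c=1..n. root_vec 1 3 c) = 0" "(\<Sum>c=1..n. root_vec 2 4 c) = 0"
    by (rule sum_root_vec; use n in simp)+
  have "(\<Sum>c=1..n. k a c) = 0" "(\<Sum>c=1..n. k c a) = 0" for a
    unfolding k_def using s
    by (simp_all add: sum.distrib sum_distrib_left[symmetric] sum_distrib_right[symmetric])
  then have "two_point n k \<in> weight_space n (two_point_weight n (-1) 0)"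
    by (intro two_point_weight_spaceI[OF n2]) (simp_all add: k_def root_vec_def)
  moreover have "two_point n k \<noteq> 0" by (rule nz) (simp add: k_def root_vec_def)
  ultimately show ?C by blast
qed

lemma sum_two_point_weight:
  assumes "n \<ge> 2"
  shows "(\<Sum>k=1..n. two_point_weight n \<alpha> \<beta> k) = (real n - 2) * (real n - 3) / 2 + \<alpha> + \<beta>"
proof -
  define m where "m = n - 2"
  have m: "n = Suc (Suc m)" using assms by (simp add: m_def)
  have "(\<Sum>k=1..n. g k) = (\<Sum>k=1..m. g k) + g (n - 1) + g n" for g :: "nat \<Rightarrow> real" by (simp add: m)
  then have "(\<Sum>k=1..n. two_point_weight n \<alpha> \<beta> k) = (\<Sum>k=1..m. two_point_weight n \<alpha> \<beta> k) + \<alpha> + \<beta>"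
    by (simp add: two_point_weight_def m)
  also have "(\<Sum>k=1..m. two_point_weight n \<alpha> \<beta> k) = (\<Sum>k=1..m. real k - 1)"
    by (intro sum.cong) (auto simp: two_point_weight_def m)
  also have "(\<Sum>k=1..j. real k - 1) = real j * (real j - 1) / 2" for j
    by (induction j) (auto simp: field_simps)
  finally show ?thesis by (simp add: m)
qed

section \<open>The adjacency matrix\<close>

text \<open>The basis vectors form the columns of a matrix \<open>P\<close> that conjugates
  \<open>M\<close> to a diagonal matrix. \<open>P\<close> is invertible because a kernel vector
  would be a linear relation between the basis functions.\<close>

lemma char_poly_eigenbasis:
  fixes vs :: "'a list" and bs :: "('a \<Rightarrow> real) list" and \<theta> :: "('a \<Rightarrow> real) \<Rightarrow> real"
  assumes M: "M \<in> carrier_mat (length vs) (length vs)"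
    and len: "length bs = length vs" and dist: "distinct bs"
    and indep: "fs.independent (set bs)" and bsG: "set bs \<subseteq> fspace (set vs)"
    and eig: "\<And>b r. b \<in> set bs \<Longrightarrow> r < length vs \<Longrightarrow>
      (\<Sum>j<length vs. M $$ (r, j) * b (vs ! j)) = \<theta> b * b (vs ! r)"
  shows "char_poly M = (\<Prod>b\<leftarrow>bs. [:- \<theta> b, 1:])"
proof -
  define N where "N = length vs"
  define P where "P = mat N N (\<lambda>(r, c). (bs ! c) (vs ! r))"
  define D where "D = mat N N (\<lambda>(r, c). if r = c then \<theta> (bs ! c) else 0)"
  have MN: "M \<in> carrier_mat N N" and P: "P \<in> carrier_mat N N" and D: "D \<in> carrier_mat N N"
    using M by (auto simp: N_def P_def D_def)
  have MP: "M * P = P * D"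
  proof (rule eq_matI)
    fix r c assume "r < dim_row (P * D)" "c < dim_col (P * D)"
    then have rc: "r < N" "c < N" using P D by auto
    have "(M * P) $$ (r, c) = (\<Sum>j<N. M $$ (r, j) * (bs ! c) (vs ! j))"
      using rc MN P by (simp add: scalar_prod_def P_def lessThan_atLeast0)
    also have "\<dots> = \<theta> (bs ! c) * (bs ! c) (vs ! r)"
      using eig[of "bs ! c" r] rc len by (simp add: N_def)
    also have "\<dots> = (\<Sum>j<N. (bs ! j) (vs ! r) * (if j = c then \<theta> (bs ! c) else 0))"
      using rc by (simp add: if_distrib cong: if_cong)
    also have "\<dots> = (P * D) $$ (r, c)"
      using rc by (simp add: scalar_prod_def P_def D_def lessThan_atLeast0)
    finally show "(M * P) $$ (r, c) = (P * D) $$ (r, c)" .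
  qed (use MN P D in auto)
  have "det P \<noteq> 0"
  proof
    assume "det P = 0"
    then obtain v where v: "v \<in> carrier_vec N" "v \<noteq> 0\<^sub>v N" "P *\<^sub>v v = 0\<^sub>v N"
      using det_0_iff_vec_prod_zero[OF P] by auto
    define u where "u b = v $ (THE c. c < N \<and> bs ! c = b)" for b
    have u: "u (bs ! c) = v $ c" if "c < N" for c
    proof -
      have "(THE c'. c' < N \<and> bs ! c' = bs ! c) = c"
        using that dist len by (intro the_equality) (auto simp: N_def nth_eq_iff_index_eq)
      then show ?thesis by (simp add: u_def)
    qed
    have reindex: "(\<Sum>b\<in>set bs. g b) = (\<Sum>c<N. g (bs ! c))" for g :: "('a \<Rightarrow> real) \<Rightarrow> real"
      using sum.reindex_bij_betw[OF bij_betw_nth[OF dist refl refl], of g] len by (simp add: N_def)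
    have "(\<Sum>b\<in>set bs. fscale (u b) b) = 0"
    proof
      fix x
      have "(\<Sum>b\<in>set bs. fscale (u b) b) x = (\<Sum>c<N. v $ c * (bs ! c) x)"
        by (simp add: sum_fun_apply fscale_apply reindex u)
      also have "\<dots> = 0"
      proof (cases "x \<in> set vs")
        case True
        then obtain r where r: "r < N" "x = vs ! r" by (auto simp: in_set_conv_nth N_def)
        have "(P *\<^sub>v v) $ r = (\<Sum>c<N. (bs ! c) x * v $ c)"
          using r v(1) by (simp add: P_def scalar_prod_def lessThan_atLeast0)
        then show ?thesis using v(3) r by (simp add: mult.commute)
      next
        case False
        have "(bs ! c) x = 0" if "c < N" for c
        proof -
          have "bs ! c \<in> fspace (set vs)" using that len bsG nth_mem[of c bs] by (auto simp: N_def)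
          then show ?thesis using False by (simp add: fspace_def)
        qed
        then show ?thesis by simp
      qed
      finally show "(\<Sum>b\<in>set bs. fscale (u b) b) x = 0 x" by (simp add: zero_fun_apply)
    qed
    then have "u b = 0" if "b \<in> set bs" for b
      using fs.independentD[OF indep _ _ _ that] by blast
    then have "v $ c = 0" if "c < N" for c using u[OF that] that len by (simp add: N_def)
    then have "v = 0\<^sub>v N" using v(1) by (intro eq_vecI) auto
    then show False using v(2) by contradiction
  qed
  from det_non_zero_imp_unit[OF P this, of "()"]
  obtain Q where Q: "Q \<in> carrier_mat N N" "P * Q = 1\<^sub>m N" "Q * P = 1\<^sub>m N"
    unfolding Units_def ring_mat_def by auto
  have "M = M * (P * Q)" using MN Q by simp
  also have "\<dots> = P * D * Q" using MP MN P Q(1) by (metis assoc_mult_mat)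
  finally have "similar_mat_wit M D P Q" using MN P D Q by (auto simp: similar_mat_wit_def Let_def)
  then have "char_poly M = char_poly D" by (intro char_poly_similar) (auto simp: similar_mat_def)
  also have "\<dots> = (\<Prod>a\<leftarrow>diag_mat D. [:- a, 1:])"
    by (rule char_poly_upper_triangular[OF D]) (auto simp: upper_triangular_def D_def)
  also have "diag_mat D = map \<theta> bs"
    using len by (intro nth_equalityI) (auto simp: diag_mat_def D_def N_def)
  finally show ?thesis by (simp add: o_def)
qed

lemma order_prod_linear:
  fixes f :: "'b \<Rightarrow> real"
  assumes "distinct bs"
  shows "Polynomial.order x (\<Prod>b\<leftarrow>bs. [:- f b, 1:]) = card {b \<in> set bs. f b = x}"
  using assms
proof (induction bs)
  case (Cons b bs)
  have nz: "(\<Prod>b\<leftarrow>bs. [:- f b, 1:]) \<noteq> 0" by (auto simp: prod_list_zero_iff)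
  have "Polynomial.order x [:- f b, 1:] = of_bool (f b = x)"
    using order_power_n_n[of x 1] order_0I[of "[:- f b, 1:]" x] by auto
  then have "Polynomial.order x (\<Prod>b\<leftarrow>b # bs. [:- f b, 1:]) = of_bool (f b = x) + card {b \<in> set bs. f b = x}"
    using Cons nz by (simp add: order_mult del: mult_pCons_left)
  also have "\<dots> = card {b' \<in> set (b # bs). f b' = x}"
  proof -
    have "{b' \<in> set (b # bs). f b' = x} = (if f b = x then {b} else {}) \<union> {b \<in> set bs. f b = x}" by auto
    then show ?thesis using Cons.prems by auto
  qed
  finally show ?case .
qed simp

text \<open>Writing each transposition with its larger entry last sorts the arcs by the operator
  \<open>JM k\<close> to which they belong.\<close>

lemma transposition_graph_arcs:
  "(x, y) \<in> parcs (transposition_graph n) \<longleftrightarrow>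
    x \<in> perms n \<and> (\<exists>k\<in>{1..n}. \<exists>i\<in>{1..<k}. y = x \<circ> transpose i k)"
proof -
  have "s \<in> transpositions n \<longleftrightarrow> (\<exists>k\<in>{1..n}. \<exists>i\<in>{1..<k}. s = transpose i k)" for s
  proof
    assume "s \<in> transpositions n"
    then obtain i j where ij: "i \<in> {1..n}" "j \<in> {1..n}" "i \<noteq> j" "s = transpose i j"
      by (auto simp: transpositions_def)
    show "\<exists>k\<in>{1..n}. \<exists>i\<in>{1..<k}. s = transpose i k"
    proof (cases "i < j")
      case True
      then have "j \<in> {1..n}" "i \<in> {1..<j}" using ij by auto
      then show ?thesis using ij(4) by blast
    next
      case False
      then have "i \<in> {1..n}" "j \<in> {1..<i}" "s = transpose j i" using ij by (auto simp: transpose_commute)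
      then show ?thesis by blast
    qed
  next
    assume "\<exists>k\<in>{1..n}. \<exists>i\<in>{1..<k}. s = transpose i k"
    then obtain i k where ik: "k \<in> {1..n}" "i \<in> {1..<k}" "s = transpose i k" by blast
    then have "i \<in> {1..n}" "i \<noteq> k" by auto
    with ik show "s \<in> transpositions n" unfolding transpositions_def by blast
  qed
  then show ?thesis
    by (auto simp: transposition_graph_def cayley_graph_def sym_group_def perms_def)
qed

lemma adjacency_sum:
  assumes x: "x \<in> perms n"
  shows "(\<Sum>y\<in>perms n. (if (x, y) \<in> parcs (transposition_graph n) then 1 else 0) * f y) = (\<Sum>k=1..n. JM k f x)"
proof -
  let ?S = "SIGMA k:{1..n}. {1..<k}"
  let ?t = "\<lambda>(k, i). x \<circ> transpose i k"
  have inj: "inj_on ?t ?S"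
  proof (rule inj_onI, clarify)
    fix k i k' i'
    assume k: "k \<in> {1..n}" "i \<in> {1..<k}" "k' \<in> {1..n}" "i' \<in> {1..<k'}" and "x \<circ> transpose i k = x \<circ> transpose i' k'"
    moreover have "inj x" using x permutes_inj by (auto simp: perms_def)
    ultimately have eq: "transpose i k = transpose i' k'" by (simp add: fun_eq_iff inj_eq)
    have "transpose i' k' i = k" "transpose i' k' k = i" by (simp_all flip: eq)
    with k show "k = k' \<and> i = i'" by (auto simp: transpose_def split: if_splits)
  qed
  have arcs: "{y \<in> perms n. (x, y) \<in> parcs (transposition_graph n)} = ?t ` ?S"
  proof (intro equalityI subsetI)
    fix y assume "y \<in> ?t ` ?S"
    then obtain k i where ki: "k \<in> {1..n}" "i \<in> {1..<k}" "y = x \<circ> transpose i k" by auto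
    then have "y \<in> perms n" using perms_transpose[OF x, of i k] by auto
    then show "y \<in> {y \<in> perms n. (x, y) \<in> parcs (transposition_graph n)}"
      using x ki unfolding transposition_graph_arcs by blast
  qed (auto simp: transposition_graph_arcs)
  have "(\<Sum>y\<in>perms n. (if (x, y) \<in> parcs (transposition_graph n) then 1 else 0) * f y)
      = (\<Sum>y\<in>{y \<in> perms n. (x, y) \<in> parcs (transposition_graph n)}. f y)"
    by (subst sum.inter_filter) (auto intro!: sum.cong)
  also have "\<dots> = (\<Sum>(k, i)\<in>?S. f (x \<circ> transpose i k))"
    unfolding arcs sum.reindex[OF inj] by (intro sum.cong) auto
  also have "\<dots> = (\<Sum>k=1..n. JM k f x)"
    unfolding JM_apply by (rule sum.Sigma[symmetric]) auto
  finally show ?thesis .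
qed

lemma sum_hook_content:
  assumes "1 \<le> p" "p < q" "q \<le> n"
  shows "(\<Sum>i=1..n. hook_content p q i) = real n * (real n - 5) / 2"
proof -
  have count: "(\<Sum>i=1..n. of_bool (r < i)) = real n - real r" if "r \<le> n" for r
  proof -
    have "{1..n} \<inter> {i. r < i} = {r<..n}" by auto
    then show ?thesis using that by (simp add: of_bool_def sum.If_cases of_nat_diff)
  qed
  \<comment> \<open>The generic first-row formula would give \<open>p - 1\<close> at
    \<open>p\<close> and \<open>q - 2\<close> at \<open>q\<close>; subtracting \<open>p\<close> and
    \<open>q\<close> there corrects this to -1 and -2.\<close>
  have "hook_content p q i = (real i - 1) - of_bool (p < i) - of_bool (q < i)
      - (if i = p then real p else 0) - (if i = q then real q else 0)" for i
    using assms by (auto simp: hook_content_def)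
  then have "(\<Sum>i=1..n. hook_content p q i) = (\<Sum>i=1..n. real i - 1) - (\<Sum>i=1..n. of_bool (p < i))
      - (\<Sum>i=1..n. of_bool (q < i)) - real p - real q"
    using assms by (simp add: sum_subtractf)
  also have "(\<Sum>i=1..n. real i - 1) = real n * (real n - 1) / 2"
    by (induction n) (auto simp: field_simps)
  also have "(\<Sum>i=1..n. of_bool (p < i)) = real n - real p" by (rule count) (use assms in simp)
  also have "(\<Sum>i=1..n. of_bool (q < i)) = real n - real q" by (rule count) (use assms in simp)
  finally show ?thesis by (simp add: field_simps)
qed

lemma real_choose_two: "real (m choose 2) = real m * (real m - 1) / 2"
  by (induction m) (auto simp: numeral_2_eq_2 field_simps)

lemma weight_unique:
  assumes "b \<in> weight_space n a" "b \<in> weight_space n c" "b \<noteq> 0" "k \<in> {1..n}"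
  shows "a k = c k"
proof (rule ccontr)
  assume "a k \<noteq> c k"
  then have "inprod (perms n) b b = 0" using weight_space_orthogonal assms by blast
  then show False using inprod_self_eq_0[OF finite_perms[of n], of b] assms weight_space_subset by blast
qed

theorem theorem5:
  fixes n :: nat and vs :: "(nat \<Rightarrow> nat) list"
  assumes "n > 6"
    and "vertex_enumeration (transposition_graph n) vs"
  shows "is_kth_largest 4
           {\<theta>. eigenvalue (adjacency_matrix (transposition_graph n) vs) \<theta>}
           (real n * (real n - 5) / 2)
       \<and> real (eigenvalue_multiplicity (adjacency_matrix (transposition_graph n) vs)
                (real n * (real n - 5) / 2))
         = ((real n - 1) * (real n - 2) / 2)\<^sup>2"
proof -
  note n = assms(1)
  have vs: "distinct vs" "set vs = perms n"
    using assms(2) by (auto simp: vertex_enumeration_def transposition_graph_def cayley_graph_def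
        sym_group_def perms_def)
  have len: "length vs = card (perms n)" using vs distinct_card by metis
  define M where "M = adjacency_matrix (transposition_graph n) vs"
  have M: "M \<in> carrier_mat (length vs) (length vs)" by (simp add: M_def adjacency_matrix_def)
  obtain B where B: "B \<subseteq> (\<Union>a. weight_space n a)" "fs.independent B" "fspace (perms n) \<subseteq> fs.span B"
    "finite B" "card B = card (perms n)"
    and dims: "\<forall>a. card (B \<inter> weight_space n a) = fs.dim (weight_space n a)"
    by (rule weight_basis_exists[of n])
  obtain bs where bs: "set bs = B" "distinct bs" using finite_distinct_list[OF B(4)] by blast
  have lenb: "length bs = length vs" using bs B(5) len distinct_card by metis
  have B0: "b \<noteq> 0" if "b \<in> B" for b using that B(2) fs.dependent_zero by blast
  have "\<forall>b\<in>B. \<exists>a. b \<in> weight_space n a" using B(1) by blast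
  from bchoice[OF this] obtain wt where wt: "\<And>b. b \<in> B \<Longrightarrow> b \<in> weight_space n (wt b)" by blast
  define \<theta> where "\<theta> b = (\<Sum>k=1..n. wt b k)" for b
  have \<theta>_eq: "\<theta> b = (\<Sum>k=1..n. a k)" if "b \<in> B" "b \<in> weight_space n a" for b a
    unfolding \<theta>_def using weight_unique[OF wt[OF that(1)] that(2) B0[OF that(1)]] by (intro sum.cong) auto
  have char: "char_poly M = (\<Prod>b\<leftarrow>bs. [:- \<theta> b, 1:])"
  proof (rule char_poly_eigenbasis[OF M lenb bs(2)])
    show "fs.independent (set bs)" using bs B by simp
    have "B \<subseteq> fspace (perms n)" using wt weight_space_subset by blast
    then show "set bs \<subseteq> fspace (set vs)" using bs vs by simp
    fix b r assume b: "b \<in> set bs" and r: "r < length vs"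
    have x: "vs ! r \<in> perms n" using r vs by auto
    let ?g = "\<lambda>y. (if (vs ! r, y) \<in> parcs (transposition_graph n) then 1 else 0) * b y"
    have "(\<Sum>j<length vs. M $$ (r, j) * b (vs ! j)) = (\<Sum>j<length vs. ?g (vs ! j))"
      using r by (intro sum.cong) (auto simp: M_def adjacency_matrix_def)
    also have "\<dots> = (\<Sum>y\<in>perms n. ?g y)"
      using sum.reindex_bij_betw[OF bij_betw_nth[OF vs(1) refl vs(2)[symmetric]], of ?g] .
    also have "\<dots> = (\<Sum>k=1..n. JM k b (vs ! r))" by (rule adjacency_sum[OF x])
    also have "\<dots> = (\<Sum>k=1..n. wt b k * b (vs ! r))"
      using wt[of b] b bs by (intro sum.cong) (auto simp: weight_space_def fscale_apply)
    finally show "(\<Sum>j<length vs. M $$ (r, j) * b (vs ! j)) = \<theta> b * b (vs ! r)"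
      by (simp add: \<theta>_def sum_distrib_right)
  qed
  have eigen: "eigenvalue M z \<longleftrightarrow> z \<in> \<theta> ` B" for z
    unfolding eigenvalue_root_char_poly[OF M] char
    by (auto simp: poly_prod_list prod_list_zero_iff bs(1)[symmetric])
  define t1 t2 t3 t4 where "t1 = real n * (real n - 1) / 2" and "t2 = real n * (real n - 3) / 2"
    and "t3 = (real n - 1) * (real n - 4) / 2" and "t4 = real n * (real n - 5) / 2"
  have order: "t4 < t3" "t3 < t2" "t2 < t1" using n by (auto simp: t1_def t2_def t3_def t4_def field_simps)
  interpret content_family n "{a. \<exists>f\<in>weight_space n a. f \<noteq> 0}"
    by (rule weights_content_family) (use n in simp)
  define H where "H = {(p, q). p \<in> {2..n} \<and> q \<in> {2..n} \<and> p < q}"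
  have classify: "\<theta> b = t1 \<or> \<theta> b = t2 \<or> \<theta> b = t3 \<or>
      (\<theta> b = t4 \<and> (\<exists>(p, q)\<in>H. b \<in> weight_space n (hook_content p q))) \<or> \<theta> b < t4" if b: "b \<in> B" for b
  proof -
    have seq: "content_seq n (wt b)" using content_seq wt[OF b] B0[OF b] by blast
    have hook: "\<exists>(p, q)\<in>H. b \<in> weight_space n (hook_content p q)"
      if m: "\<forall>c. c + 3 \<le> n \<longrightarrow> content_mult n (wt b) (real c) = 1" "content_mult n (wt b) (-1) = 1" "content_mult n (wt b) (-2) = 1"
    proof -
      obtain p q where pq: "2 \<le> p" "p < q" "q \<le> n" "\<And>i. i \<in> {1..n} \<Longrightarrow> wt b i = hook_content p q i"
        using hook_content_of_mult[OF seq n _ m(2,3)] m(1) by blast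
      then have "b \<in> weight_space n (hook_content p q)"
        using wt[OF b] weight_space_cong[of n "wt b" "hook_content p q"] by blast
      moreover have "(p, q) \<in> H" using pq by (auto simp: H_def)
      ultimately show ?thesis by blast
    qed
    show ?thesis
      using content_sum_classification[OF seq n] hook unfolding \<theta>_def t1_def t2_def t3_def t4_def by blast
  qed
  \<comment> \<open>A weight space of positive dimension contains a vector of the adapted basis, so
    its content sum is among the eigenvalues.\<close>
  have attained: "(\<Sum>k=1..n. a k) \<in> \<theta> ` B" if pos: "fs.dim (weight_space n a) > 0" for a
  proof -
    have "B \<inter> weight_space n a \<noteq> {}" using dims pos by (metis card.empty less_irrefl)
    then obtain b where b: "b \<in> B" "b \<in> weight_space n a" by blast
    then show ?thesis using \<theta>_eq[OF b] by (metis imageI)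
  qed
  have dim_pos: "fs.dim (weight_space n a) > 0" if "\<exists>f\<in>weight_space n a. f \<noteq> 0" for a
  proof (rule ccontr)
    assume "\<not> 0 < fs.dim (weight_space n a)"
    obtain C where C: "C \<subseteq> weight_space n a" "fs.independent C" "weight_space n a \<subseteq> fs.span C"
      by (rule fs.maximal_independent_subset)
    have "finite C" using fspace_independent_finite[OF finite_perms C(2)] C(1) weight_space_subset by blast
    moreover have "card C = 0" using fs.basis_card_eq_dim[OF C(1,3,2)] \<open>\<not> 0 < _\<close> by simp
    ultimately have "C = {}" by simp
    then show False using C(3) that by auto
  qed
  have hook_dim: "fs.dim (weight_space n (hook_content p q)) = (n - 1) choose 2" if "(p, q) \<in> H" for p q
    using that dim_hook_weight_space[of p q n] dim_hook_last[of n] n by (auto simp: H_def)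
  have hook_sum: "(\<Sum>k=1..n. hook_content p q k) = t4" if "(p, q) \<in> H" for p q
    using that sum_hook_content[of p q n] by (auto simp: H_def t4_def)
  have t123: "t1 \<in> \<theta> ` B" "t2 \<in> \<theta> ` B" "t3 \<in> \<theta> ` B"
  proof -
    have s1: "(\<Sum>k=1..n. two_point_weight n (real n - 2) (real n - 1) k) = t1"
      and s2: "(\<Sum>k=1..n. two_point_weight n (real n - 2) (-1) k) = t2"
      and s3: "(\<Sum>k=1..n. two_point_weight n (-1) 0 k) = t3"
      by (subst sum_two_point_weight; use n in \<open>simp add: t1_def t2_def t3_def field_simps\<close>)+
    have n4: "n \<ge> 4" using n by simp
    show "t1 \<in> \<theta> ` B" "t2 \<in> \<theta> ` B" "t3 \<in> \<theta> ` B"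
      using attained[OF dim_pos[OF largest_weights_exist(1)[OF n4]]]
        attained[OF dim_pos[OF largest_weights_exist(2)[OF n4]]]
        attained[OF dim_pos[OF largest_weights_exist(3)[OF n4]]]
      unfolding s1 s2 s3 .
  qed
  have mult: "card {b \<in> B. \<theta> b = t4} = ((n - 1) choose 2)\<^sup>2"
  proof -
    have "{b \<in> B. \<theta> b = t4} = (\<Union>(p, q)\<in>H. B \<inter> weight_space n (hook_content p q))"
    proof (intro equalityI subsetI)
      fix b assume "b \<in> {b \<in> B. \<theta> b = t4}"
      then show "b \<in> (\<Union>(p, q)\<in>H. B \<inter> weight_space n (hook_content p q))"
        using classify[of b] order by fastforce
    next
      fix b assume "b \<in> (\<Union>(p, q)\<in>H. B \<inter> weight_space n (hook_content p q))"
      then obtain p q where "(p, q) \<in> H" "b \<in> B" "b \<in> weight_space n (hook_content p q)" by blast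
      then show "b \<in> {b \<in> B. \<theta> b = t4}" using \<theta>_eq[of b "hook_content p q"] hook_sum by simp
    qed
    also have "card \<dots> = (\<Sum>(p, q)\<in>H. card (B \<inter> weight_space n (hook_content p q)))"
    proof (subst card_UN_disjoint)
      show "finite H" by (rule finite_subset[of _ "{2..n} \<times> {2..n}"]) (auto simp: H_def)
      show "\<forall>i\<in>H. finite (case i of (p, q) \<Rightarrow> B \<inter> weight_space n (hook_content p q))" using B(4) by auto
      show "\<forall>i\<in>H. \<forall>j\<in>H. i \<noteq> j \<longrightarrow> (case i of (p, q) \<Rightarrow> B \<inter> weight_space n (hook_content p q)) \<inter>
          (case j of (p, q) \<Rightarrow> B \<inter> weight_space n (hook_content p q)) = {}"
      proof (clarify, rule ccontr)
        fix p q p' q' assume pq: "(p, q) \<in> H" "(p', q') \<in> H" "\<not> (p = p' \<and> q = q')"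
          and "B \<inter> weight_space n (hook_content p q) \<inter> (B \<inter> weight_space n (hook_content p' q')) \<noteq> {}"
        then obtain b where b: "b \<in> B" "b \<in> weight_space n (hook_content p q)"
          "b \<in> weight_space n (hook_content p' q')" by blast
        \<comment> \<open>A nonzero vector has only one weight, and a hook weight reveals
          \<open>p\<close> and \<open>q\<close> as the places of -1 and -2.\<close>
        have "hook_content p q k = hook_content p' q' k" if "k \<in> {1..n}" for k
          using weight_unique[OF b(2,3) B0[OF b(1)] that] .
        from this[of p] this[of q] pq show False
          by (auto simp: H_def hook_content_def of_bool_def split: if_splits)
      qed
    qed (simp add: case_prod_unfold)
    \<comment> \<open>One factor is the dimension of each hook weight space, the other the number of
      pairs in the \<open>n - 1\<close> elements of \<open>{2..n}\<close>.\<close>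
    also have "\<dots> = (\<Sum>i\<in>H. (n - 1) choose 2)"
      using dims hook_dim by (intro sum.cong) auto
    also have "\<dots> = ((n - 1) choose 2)\<^sup>2"
      using card_pairs[of "{2..n}"] by (simp add: H_def power2_eq_square)
    finally show ?thesis .
  qed
  have "(n - 1, n) \<in> H" using n by (auto simp: H_def)
  then have t4: "t4 \<in> \<theta> ` B"
    using attained[of "hook_content (n - 1) n"] hook_dim hook_sum n by simp
  \<comment> \<open>The strict order of the four values makes exactly three distinct eigenvalues
    larger.\<close>
  have above: "{y \<in> \<theta> ` B. t4 < y} = {t1, t2, t3}"
    using t123 order classify by fastforce
  have "is_kth_largest 4 {z. eigenvalue M z} t4"
    using t4 order unfolding is_kth_largest_def eigen Collect_mem_eq above by simp
  moreover have "eigenvalue_multiplicity M t4 = ((n - 1) choose 2)\<^sup>2"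
    unfolding eigenvalue_multiplicity_def char order_prod_linear[OF bs(2)] bs(1) by (rule mult)
  then have "real (eigenvalue_multiplicity M t4) = ((real n - 1) * (real n - 2) / 2)\<^sup>2"
    using n by (simp add: real_choose_two of_nat_diff)
  ultimately show ?thesis unfolding M_def t4_def by blast
qed

end
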